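(* Let $k \geq 2$, let $n_1,\dots,n_k$, $t$ and $r_1,\dots,r_k$ be positive integers with $t \leq r_1 \leq \dots \leq r_k$, let $u$ be a non-negative real number such that $u > \frac{6-t}{3}$, and suppose $\min\{n_1, \dots, n_k\} \geq (t+u+2)(r_k-t)+r_{k-1}-1$. If $\mathcal{A}_1 \subseteq \binom{[n_1]}{r_1}, \dots, \mathcal{A}_k \subseteq \binom{[n_k]}{r_k}$, and $\mathcal{A}_1, \dots, \mathcal{A}_k$ are cross-$t$-intersecting, then \[\prod_{i=1}^k |\mathcal{A}_i| \leq \prod_{i=1}^k \binom{n_i-t}{r_i - t}.\] Moreover, if $u > 0$, then the bound is attained if and only if for some $t$-element subset $T$ of $[\min\{n_1, \dots, n_k\}]$, $\mathcal{A}_i = \{A \in \binom{[n_i]}{r_i} : T \subseteq A\}$ for each $i \in [k]$.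
   Context: $[n]=\{1,\dots,n\}$, and $\binom{X}{r}$ is the family of all $r$-element subsets of a set $X$. Families $\mathcal{A}_1,\dots,\mathcal{A}_k$ (not necessarily distinct or non-empty) are cross-$t$-intersecting if for all $i,j \in [k]$ with $i \neq j$, $|A \cap B| \geq t$ for every $A \in \mathcal{A}_i$ and every $B \in \mathcal{A}_j$. For numerical binomial coefficients, the usual convention $\binom{a}{0}=1$ for every integer $a$ is used. *)

theory Defs
  imports Complex_Main "HOL-Library.Ramsey"
begin

(* nsets X r, from HOL-Library.Ramsey, is the family of all r-element subsets of X. *)

definition cross_intersecting :: "nat \<Rightarrow> nat \<Rightarrow> (nat \<Rightarrow> 'a set set) \<Rightarrow> bool" where
  "cross_intersecting t k \<A> \<longleftrightarrow>
    (\<forall>i\<in>{1..k}. \<forall>j\<in>{1..k}. i \<noteq> j \<longrightarrow>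
      (\<forall>A\<in>\<A> i. \<forall>B\<in>\<A> j. card (A \<inter> B) \<ge> t))"

(* Pitfall: card is 0 on infinite sets, so cross_intersecting has its intended meaning for
   families of finite sets only; it is used for subfamilies of nsets {1..n} r. *)

(* Truncated subtraction in (n - t) choose (r - t) with t \<le> r: the only case in which n < t
   can occur below the lower bound imposed on n is n = t - 1, r = t, where the truncated
   expression is 0 choose 0 = 1, in agreement with the convention that a choose 0 = 1
   for every integer a. *)

end

theory Submission
  imports Defs
begin

text \<open>
  Write \<open>lam = t + u\<close>. The lower bounds on \<open>u\<close> enter only through \<open>lam \<ge> t\<close> and \<open>lam > (t + 4) / 2\<close>,
  and the case \<open>u > 0\<close> through \<open>lam > t\<close>.
  
  It is enough to treat two families. If \<open>a i * a j \<le> c i * c j\<close> for every pair, then at most one factor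
  \<open>a i\<close> exceeds \<open>c i\<close>, and it can be absorbed by any other factor (\<open>prod_le_from_pairs\<close>).
  
  For two families take a pair with the largest product of sizes. Shifting, that is, replacing an element
  of a set by a smaller one wherever this gives a new set, preserves uniformity, sizes and the
  cross-intersection property, so the pair may be taken to be compressed (stable under all shifts). Any two
  members of a compressed pair already meet in \<open>t\<close> elements of \<open>{1..l}\<close> for \<open>l = r + s - t\<close>
  (\<open>trace_cross\<close>). Hence only the traces on \<open>{1..l}\<close> matter, a trace of size \<open>a\<close> being counted with the
  weight \<open>(m - l) choose (r - a)\<close>, the number of \<open>r\<close>-sets that have it. The lower bound on the ground sets
  says exactly that this weight drops at least by the factor \<open>lam\<close> with each element beyond the first \<open>t\<close>
  (\<open>ext_count_ratio\<close>).
  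
  The weighted problem (\<open>optimal_pair_fixing\<close>) is solved by induction on \<open>l\<close>. If \<open>l\<close> can be removed from every
  member of both families without leaving the family, everything is determined by the traces on
  \<open>{1..l - 1}\<close>, with weights that again satisfy the ratio condition. Otherwise some member \<open>A\<close> of size \<open>i\<close> is
  critical: it contains \<open>l\<close>, and \<open>A - {l}\<close> is not in its family. Since the pair is compressed, \<open>A - {l}\<close> can
  only be blocked by critical sets of size \<open>j = l + t - i\<close> of the other family. So one may delete those and
  add \<open>A - {l}\<close> for all critical \<open>A\<close> of size \<open>i\<close>. If \<open>a\<close> and \<open>b\<close> are the fractions of the two weights that
  are due to these critical sets, optimality gives \<open>lam * a * (1 - b) \<le> b\<close> and, symmetrically,
  \<open>lam * b * (1 - a) \<le> a\<close>; together they force \<open>a\<close> and \<open>b\<close> to be at least \<open>1 - 1 / lam\<close>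
  (\<open>ratio_contradiction\<close>). Shifting the critical sets shows on the other hand \<open>a \<le> i / l\<close> and \<open>b \<le> j / l\<close>
  (\<open>critical_fraction\<close>). These bounds are incompatible except when \<open>i\<close> or \<open>j\<close> equals \<open>t\<close>, or
  \<open>i = j = t + 1\<close>; the two exceptions are compared with the star directly.
  
  For the equality case, the weighted argument shows that an optimal compressed pair consists of sets
  containing \<open>{1..t}\<close>. This is carried back through the shifts one at a time (\<open>unshift_star\<close>): if shifting
  turns an optimal pair into a pair of stars with centre \<open>T\<close>, then every set of the original pair contains
  \<open>T\<close> or the set \<open>T'\<close> that the shift turns into \<open>T\<close>, and since the ground sets are large, the choice between
  \<open>T\<close> and \<open>T'\<close> must be the same throughout.
\<close>

section \<open>Cross-intersecting pairs, compressed families and weights\<close>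

definition cross :: "nat \<Rightarrow> 'a set set \<Rightarrow> 'a set set \<Rightarrow> bool" where
  "cross t \<A> \<B> \<longleftrightarrow> (\<forall>A\<in>\<A>. \<forall>B\<in>\<B>. t \<le> card (A \<inter> B))"

lemma crossD: "cross t \<A> \<B> \<Longrightarrow> A \<in> \<A> \<Longrightarrow> B \<in> \<B> \<Longrightarrow> t \<le> card (A \<inter> B)"
  by (auto simp: cross_def)

lemma cross_sym: "cross t \<A> \<B> \<Longrightarrow> cross t \<B> \<A>"
  by (metis cross_def Int_commute)

definition compressed :: "nat set set \<Rightarrow> bool" where
  "compressed \<A> \<longleftrightarrow>
    (\<forall>A\<in>\<A>. \<forall>x y. 0 < x \<longrightarrow> x < y \<longrightarrow> y \<in> A \<longrightarrow> x \<notin> A \<longrightarrow> insert x (A - {y}) \<in> \<A>)"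

lemma compressedD:
  "compressed \<A> \<Longrightarrow> A \<in> \<A> \<Longrightarrow> 0 < x \<Longrightarrow> x < y \<Longrightarrow> y \<in> A \<Longrightarrow> x \<notin> A \<Longrightarrow> insert x (A - {y}) \<in> \<A>"
  unfolding compressed_def by blast

definition weight :: "(nat \<Rightarrow> real) \<Rightarrow> nat set set \<Rightarrow> real" where
  "weight w \<A> = (\<Sum>A\<in>\<A>. w (card A))"

definition fixing :: "nat \<Rightarrow> nat \<Rightarrow> nat set set" where
  "fixing t l = {X \<in> Pow {1..l}. {1..t} \<subseteq> X}"

text \<open>
  The members of size \<open>i\<close> that obstruct the reduction from \<open>{1..l}\<close> to \<open>{1..l - 1}\<close>.
\<close>
definition critical :: "nat \<Rightarrow> nat set set \<Rightarrow> nat \<Rightarrow> nat set set" where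
  "critical l \<A> i = {A \<in> \<A>. l \<in> A \<and> A - {l} \<notin> \<A> \<and> card A = i}"

lemma critical_subset: "critical l \<A> i \<subseteq> \<A>"
  by (auto simp: critical_def)

lemma weight_critical: "weight w (critical l \<A> i) = real (card (critical l \<A> i)) * w i"
  unfolding weight_def by (simp add: critical_def)

lemma finite_sub_Pow: "\<A> \<subseteq> Pow {1..l::nat} \<Longrightarrow> finite \<A>"
  by (meson finite_Pow_iff finite_atLeastAtMost finite_subset)

lemma cross_fixing: assumes "t \<le> l" shows "cross t (fixing t l) (fixing t l)"
proof -
  have "t \<le> card (A \<inter> B)" if "{1..t} \<subseteq> A" "{1..t} \<subseteq> B" "A \<subseteq> {1..l}" for A B :: "nat set"
  proof -
    have "card {1..t} \<le> card (A \<inter> B)"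
      using that by (intro card_mono) (auto intro: finite_subset)
    thus ?thesis by simp
  qed
  thus ?thesis by (auto simp: cross_def fixing_def)
qed

lemma weight_mono:
  "finite \<D> \<Longrightarrow> \<C> \<subseteq> \<D> \<Longrightarrow> (\<And>a. 0 \<le> w a) \<Longrightarrow> weight w \<C> \<le> weight w \<D>"
  unfolding weight_def by (rule sum_mono2) auto

lemma weight_large_sets:
  assumes "\<S> \<subseteq> Pow {1..l}" "\<And>X. X \<in> \<S> \<Longrightarrow> l \<le> Suc (card X)" and w: "\<And>a. 0 \<le> w a"
  shows "weight w \<S> \<le> l * w (l - 1) + w l"
proof -
  let ?I = "(\<lambda>m. {1..l} - {m}) ` {1..l}"
  have "\<S> \<subseteq> insert {1..l} ?I"
  proof
    fix X assume X: "X \<in> \<S>"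
    hence s: "X \<subseteq> {1..l}" and c: "l \<le> Suc (card X)" using assms by auto
    show "X \<in> insert {1..l} ?I"
    proof (cases "X = {1..l}")
      case False
      then obtain m where m: "m \<in> {1..l}" "m \<notin> X" using s by blast
      have "card X \<ge> card ({1..l} - {m})" using c m by simp
      hence "X = {1..l} - {m}" using s m by (intro card_seteq) auto
      thus ?thesis using m by auto
    qed simp
  qed
  hence "weight w \<S> \<le> weight w (insert {1..l} ?I)" by (intro weight_mono w) auto
  also have "\<dots> = w l + weight w ?I"
    unfolding weight_def by (subst sum.insert) auto
  also have "weight w ?I = (\<Sum>X\<in>?I. w (l - 1))" unfolding weight_def by (rule sum.cong) auto
  also have "\<dots> = card ?I * w (l - 1)" by simp
  also have "\<dots> \<le> l * w (l - 1)"
    using card_image_le[of "{1..l}" "\<lambda>m. {1..l} - {m}"] by (intro mult_right_mono w) simp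
  finally show ?thesis by simp
qed

text \<open>
  Weighing a family on \<open>{1..l}\<close> by \<open>w a + w (Suc a)\<close> amounts to putting back the element \<open>l + 1\<close> in all
  possible ways; this is the change of weights in the induction on \<open>l\<close>.
\<close>
lemma weight_double:
  assumes C: "\<C> \<subseteq> Pow {1..l}"
  shows "weight w (\<C> \<union> insert (Suc l) ` \<C>) = weight (\<lambda>a. w a + w (Suc a)) \<C>"
proof -
  have nl: "Suc l \<notin> X \<and> finite X" if "X \<in> \<C>" for X
  proof -
    have "X \<subseteq> {1..l}" using that C by auto
    thus ?thesis by (auto intro: finite_subset)
  qed
  have inj: "inj_on (insert (Suc l)) \<C>" using nl by (metis inj_onI insert_ident)
  have "weight w (\<C> \<union> insert (Suc l) ` \<C>) = weight w \<C> + weight w (insert (Suc l) ` \<C>)"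
    unfolding weight_def by (rule sum.union_disjoint) (use nl finite_sub_Pow[OF C] in auto)
  also have "weight w (insert (Suc l) ` \<C>) = (\<Sum>X\<in>\<C>. w (Suc (card X)))"
    unfolding weight_def sum.reindex[OF inj] by (rule sum.cong) (use nl in auto)
  finally show ?thesis by (simp add: weight_def sum.distrib)
qed

lemma fixing_Suc: "t \<le> l \<Longrightarrow> fixing t (Suc l) = fixing t l \<union> insert (Suc l) ` fixing t l"
proof (intro set_eqI iffI)
  fix X assume tl: "t \<le> l" and X: "X \<in> fixing t (Suc l)"
  have "{1..Suc l} = insert (Suc l) {1..l}" by auto
  hence 1: "X \<subseteq> insert (Suc l) {1..l}" "{1..t} \<subseteq> X" using X by (auto simp: fixing_def)
  show "X \<in> fixing t l \<union> insert (Suc l) ` fixing t l"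
  proof (cases "Suc l \<in> X")
    case True
    have "X - {Suc l} \<in> fixing t l" using 1 tl by (auto simp: fixing_def)
    thus ?thesis using True by (metis UnI2 image_eqI insert_Diff)
  next
    case False thus ?thesis using 1 by (auto simp: fixing_def)
  qed
next
  fix X assume "t \<le> l" "X \<in> fixing t l \<union> insert (Suc l) ` fixing t l"
  thus "X \<in> fixing t (Suc l)" by (fastforce simp: fixing_def)
qed

lemma fixing_self: "fixing t t = {{1..t}}" by (auto simp: fixing_def)

lemma weight_fixing_Suc:
  "t \<le> l \<Longrightarrow> weight w (fixing t (Suc l)) = weight (\<lambda>a. w a + w (Suc a)) (fixing t l)"
  by (subst fixing_Suc, simp, rule weight_double) (auto simp: fixing_def)

lemma weight_fixing_self: "weight w (fixing t t) = w t"
  by (simp add: fixing_self weight_def)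

text \<open>
  With \<open>a = P / W\<close> and \<open>b = Q / V\<close> the assumptions read \<open>lam * a * (1 - b) \<le> b\<close>, \<open>lam * b * (1 - a) \<le> a\<close>
  and \<open>a < 1 - 1 / lam\<close>. The second and third give \<open>b < a\<close>, so \<open>b < 1 - 1 / lam\<close> as well, and then the
  first gives \<open>a < b\<close>.
\<close>
lemma ratio_contradiction:
  fixes W V P Q lam :: real
  assumes "0 < W" "0 < V" "0 < P" "0 < Q" "0 < lam"
    and 1: "lam * P * (V - Q) \<le> W * Q" and 2: "lam * Q * (W - P) \<le> V * P"
    and 3: "W < lam * (W - P)"
  shows False
proof -
  have "Q * W < Q * (lam * (W - P))" using 3 assms by simp
  hence a: "W * Q < V * P" using 2 by (simp add: algebra_simps)
  have "P * (lam * (V - Q)) < P * V" using a 1 by (simp add: algebra_simps)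
  hence b: "lam * (V - Q) < V" using \<open>0 < P\<close> by simp
  have "V * (W - P) < W * (V - Q)" using a by (simp add: algebra_simps)
  hence "lam * (V * (W - P)) < lam * (W * (V - Q))" using \<open>0 < lam\<close> by simp
  also have "\<dots> = W * (lam * (V - Q))" by simp
  also have "\<dots> < W * V" using b \<open>0 < W\<close> by simp
  also have "\<dots> < V * (lam * (W - P))" using 3 \<open>0 < V\<close> by (simp add: mult.commute)
  finally show False by (simp add: algebra_simps)
qed

section \<open>The weighted problem: critical sets of an optimal compressed pair\<close>

text \<open>
  Sets of weight zero are excluded from both families, so that critical sets have positive weight.
  Only sizes from \<open>t\<close> on are constrained by the ratio condition, because the members of two nonempty
  cross-intersecting families have at least \<open>t\<close> elements. The assumptions are symmetric in the two
  families, which is used through \<open>swap\<close>.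
\<close>
locale optimal_pair =
  fixes t l :: nat and lam :: real and w v :: "nat \<Rightarrow> real" and \<A> \<B> :: "nat set set"
  assumes t_pos: "0 < t" and t_le_l: "t \<le> l"
    and lam_t: "real t \<le> lam" and lam_big: "(real t + 4) / 2 < lam"
    and w_nonneg: "\<And>a. 0 \<le> w a" and v_nonneg: "\<And>a. 0 \<le> v a"
    and w_ratio: "\<And>a. t \<le> a \<Longrightarrow> lam * w (Suc a) \<le> w a"
    and v_ratio: "\<And>a. t \<le> a \<Longrightarrow> lam * v (Suc a) \<le> v a"
    and subA: "\<A> \<subseteq> Pow {1..l}" and subB: "\<B> \<subseteq> Pow {1..l}"
    and comprA: "compressed \<A>" and comprB: "compressed \<B>"
    and crossAB: "cross t \<A> \<B>"
    and neA: "\<A> \<noteq> {}" and neB: "\<B> \<noteq> {}"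
    and posA: "\<And>A. A \<in> \<A> \<Longrightarrow> 0 < w (card A)" and posB: "\<And>B. B \<in> \<B> \<Longrightarrow> 0 < v (card B)"
    and opt: "\<And>\<C> \<D>. \<C> \<subseteq> Pow {1..l} \<Longrightarrow> \<D> \<subseteq> Pow {1..l} \<Longrightarrow> cross t \<C> \<D> \<Longrightarrow>
               weight w \<C> * weight v \<D> \<le> weight w \<A> * weight v \<B>"
begin

lemma swap: "optimal_pair t l lam v w \<B> \<A>"
proof -
  have "weight v \<C> * weight w \<D> \<le> weight v \<B> * weight w \<A>"
    if "\<C> \<subseteq> Pow {1..l}" "\<D> \<subseteq> Pow {1..l}" "cross t \<C> \<D>" for \<C> \<D>
    using opt[OF that(2,1) cross_sym[OF that(3)]] by (simp add: mult.commute)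
  thus ?thesis
    using t_pos t_le_l lam_t lam_big w_nonneg v_nonneg w_ratio v_ratio subA subB comprA comprB
      cross_sym[OF crossAB] neA neB posA posB
    by unfold_locales
qed

lemma finA: "finite \<A>" and finB: "finite \<B>"
  using subA subB finite_sub_Pow by auto

lemma lam_gt2: "2 < lam" using lam_big by simp

lemma W_pos: "0 < weight w \<A>"
  unfolding weight_def using finA neA posA by (intro sum_pos) auto

lemma V_pos: "0 < weight v \<B>"
  unfolding weight_def using finB neB posB by (intro sum_pos) auto

lemma memA: "A \<in> \<A> \<Longrightarrow> A \<subseteq> {1..l} \<and> finite A \<and> t \<le> card A \<and> card A \<le> l"
proof -
  assume A: "A \<in> \<A>"
  obtain B where B: "B \<in> \<B>" using neB by auto
  have s: "A \<subseteq> {1..l}" using A subA by auto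
  hence f: "finite A" by (rule finite_subset) simp
  have "t \<le> card (A \<inter> B)" using crossD[OF crossAB A B] .
  also have "\<dots> \<le> card A" using f by (intro card_mono) auto
  finally show ?thesis using s f card_mono[OF _ s] by simp
qed

text \<open>
  If the two sets met in exactly \<open>t\<close> elements, their union would have \<open>card A + card B - t \<noteq> l\<close> elements, so
  it would miss some \<open>x\<close>; replacing \<open>l\<close> by \<open>x\<close> in \<open>B\<close> then lowers the intersection below \<open>t\<close>.
\<close>
lemma cross_Suc:
  assumes A: "A \<in> \<A>" "l \<in> A" and B: "B \<in> \<B>" "l \<in> B" and ne: "card A + card B \<noteq> l + t"
  shows "Suc t \<le> card (A \<inter> B)"
proof (rule ccontr)
  interpret sw: optimal_pair t l lam v w \<B> \<A> by (rule swap)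
  assume "\<not> ?thesis"
  with crossD[OF crossAB A(1) B(1)] have ct: "card (A \<inter> B) = t" by simp
  have sA: "A \<subseteq> {1..l}" "finite A" and sB: "B \<subseteq> {1..l}" "finite B"
    using memA[OF A(1)] sw.memA[OF B(1)] by auto
  have "card (A \<union> B) \<noteq> l" using card_Un_Int[OF sA(2) sB(2)] ct ne by linarith
  hence "A \<union> B \<noteq> {1..l}" by auto
  then obtain x where x: "x \<in> {1..l}" "x \<notin> A" "x \<notin> B" using sA sB by blast
  have "x < l" using x A(2) by (metis atLeastAtMost_iff le_neq_implies_less)
  hence "insert x (B - {l}) \<in> \<B>" using compressedD[OF comprB B(1), of x l] x B(2) by auto
  from crossD[OF crossAB A(1) this] have "t \<le> card (A \<inter> insert x (B - {l}))" .
  moreover have "A \<inter> insert x (B - {l}) = (A \<inter> B) - {l}" using x by auto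
  moreover have "card ((A \<inter> B) - {l}) < t" using ct A(2) B(2) sA t_pos by simp
  ultimately show False by simp
qed

text \<open>
  Only critical sets of the complementary size \<open>l + t - card A\<close> can prevent the removal of \<open>l\<close> from \<open>A\<close>: a
  set \<open>B\<close> with \<open>B - {l}\<close> in its family does not need \<open>l\<close> to meet \<open>A\<close> in \<open>t\<close> elements, and a set of any other
  size meets \<open>A\<close> in one element more than required.
\<close>
lemma remove_last:
  assumes A: "A \<in> \<A>" and l: "l \<in> A" and B: "B \<in> \<B>" and nB: "B \<notin> critical l \<B> (l + t - card A)"
  shows "t \<le> card ((A - {l}) \<inter> B)"
proof (cases "l \<in> B")
  case False
  hence "(A - {l}) \<inter> B = A \<inter> B" by auto
  thus ?thesis using crossD[OF crossAB A B] by simp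
next
  case True
  show ?thesis
  proof (cases "B - {l} \<in> \<B>")
    case T2: True
    have "(A - {l}) \<inter> B = A \<inter> (B - {l})" by auto
    thus ?thesis using crossD[OF crossAB A T2] by simp
  next
    case False
    hence "card B \<noteq> l + t - card A" using nB B True by (auto simp: critical_def)
    hence "card A + card B \<noteq> l + t" by linarith
    from cross_Suc[OF A l B True this] have "Suc t \<le> card (A \<inter> B)" .
    moreover have "(A - {l}) \<inter> B = (A \<inter> B) - {l}" by auto
    ultimately show ?thesis using l True memA[OF A] by simp
  qed
qed

text \<open>
  The exchange described in the introduction: adding \<open>A - {l}\<close> for all critical \<open>A\<close> of size \<open>i\<close> and deleting
  the critical sets of size \<open>j\<close> from the other family cannot increase the product. The gain in the first
  family is at least \<open>lam\<close> times the weight of its critical sets; the ratio condition is applied at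
  \<open>i - 1\<close>, whence \<open>t < i\<close>.
\<close>
lemma alteration:
  assumes ij: "i + j = l + t" and ti: "t < i"
  shows "lam * weight w (critical l \<A> i) * (weight v \<B> - weight v (critical l \<B> j)) \<le> weight w \<A> * weight v (critical l \<B> j)"
proof -
  let ?K = "critical l \<A> i" and ?L = "critical l \<B> j"
  let ?f = "\<lambda>A. A - {l}"
  define C where "C = \<A> \<union> ?f ` ?K"
  define D where "D = \<B> - ?L"
  have j: "j = l + t - i" using ij by simp
  have fK: "finite ?K" using finA critical_subset finite_subset by metis
  have CP: "C \<subseteq> Pow {1..l}" using subA critical_subset[of l \<A> i] unfolding C_def by blast
  have DP: "D \<subseteq> Pow {1..l}" using subB unfolding D_def by auto
  have "cross t C D"
    unfolding cross_def
  proof (intro ballI)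
    fix X Y assume X: "X \<in> C" and Y: "Y \<in> D"
    show "t \<le> card (X \<inter> Y)"
    proof (cases "X \<in> \<A>")
      case True thus ?thesis using crossD[OF crossAB] Y unfolding D_def by auto
    next
      case False
      then obtain A where A: "A \<in> ?K" "X = A - {l}" using X unfolding C_def by auto
      hence "A \<in> \<A>" "l \<in> A" "card A = i" by (auto simp: critical_def)
      thus ?thesis using remove_last[of A Y] Y A(2) unfolding D_def j by auto
    qed
  qed
  from opt[OF CP DP this] have o: "weight w C * weight v D \<le> weight w \<A> * weight v \<B>" .
  have inj: "inj_on ?f ?K"
    unfolding inj_on_def critical_def by auto
  have "weight w C = weight w \<A> + weight w (?f ` ?K)"
    unfolding C_def weight_def by (rule sum.union_disjoint) (use finA fK in \<open>auto simp: critical_def\<close>)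
  also have "weight w (?f ` ?K) = (\<Sum>A\<in>?K. w (card (A - {l})))"
    unfolding weight_def by (subst sum.reindex[OF inj]) simp
  also have "\<dots> = (\<Sum>A\<in>?K. w (i - 1))"
    by (rule sum.cong) (use memA in \<open>auto simp: critical_def\<close>)
  also have "\<dots> = card ?K * w (i - 1)" by simp
  finally have wC: "weight w C = weight w \<A> + card ?K * w (i - 1)" .
  have "lam * w (Suc (i - 1)) \<le> w (i - 1)" using w_ratio[of "i - 1"] ti by simp
  hence "lam * w i \<le> w (i - 1)" using ti by simp
  hence "card ?K * (lam * w i) \<le> card ?K * w (i - 1)" by (rule mult_left_mono) simp
  hence "lam * weight w ?K \<le> card ?K * w (i - 1)" unfolding weight_critical by (simp add: algebra_simps)
  hence wC': "weight w \<A> + lam * weight w ?K \<le> weight w C" using wC by simp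
  have wD: "weight v D = weight v \<B> - weight v ?L"
    unfolding D_def weight_def by (rule sum_diff[OF finB critical_subset])
  have "0 \<le> weight v D" unfolding weight_def by (intro sum_nonneg v_nonneg)
  hence "(weight w \<A> + lam * weight w ?K) * weight v D \<le> weight w C * weight v D" using wC' by (rule mult_right_mono[rotated])
  with o have "(weight w \<A> + lam * weight w ?K) * weight v D \<le> weight w \<A> * weight v \<B>" by simp
  thus ?thesis unfolding wD by (simp add: algebra_simps)
qed

lemma critical_shift:
  assumes "A \<in> critical l \<A> i" "x \<in> {1..l} - A"
  shows "insert x (A - {l}) \<in> \<A>" "card (insert x (A - {l})) = i" "l \<notin> insert x (A - {l})"
proof -
  have A: "A \<in> \<A>" "l \<in> A" "card A = i" using assms by (auto simp: critical_def)
  have "x < l" using assms A by (metis DiffD1 DiffD2 atLeastAtMost_iff le_neq_implies_less)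
  thus "insert x (A - {l}) \<in> \<A>" using compressedD[OF comprA A(1), of x l] A assms by auto
  show "l \<notin> insert x (A - {l})" using \<open>x < l\<close> by auto
  have "card A > 0" using A memA card_gt_0_iff by blast
  thus "card (insert x (A - {l})) = i" using A assms memA[OF A(1)] by simp
qed

lemma weight_sub_mono: "S \<subseteq> \<A> \<Longrightarrow> weight w S \<le> weight w \<A>"
  unfolding weight_def by (rule sum_mono2[OF finA]) (auto intro: w_nonneg)

text \<open>
  A critical set of size \<open>i\<close> gives rise to \<open>l - i\<close> members of size \<open>i\<close> avoiding \<open>l\<close> by replacing \<open>l\<close>, and
  each of these arises at most \<open>i\<close> times, once for each candidate for the new element. Since all the sets
  involved have the same size, hence the same weight, the critical ones account for at most the fraction
  \<open>i / l\<close>.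
\<close>
lemma critical_fraction: "l * weight w (critical l \<A> i) \<le> i * weight w \<A>"
proof -
  let ?K = "critical l \<A> i"
  define I where "I = {X \<in> \<A>. l \<notin> X \<and> card X = i}"
  have fK: "finite ?K" using finA critical_subset finite_subset by metis
  have fI: "finite I" unfolding I_def using finA by simp
  let ?g = "\<lambda>(A, x). (insert x (A - {l}), x)"
  have cI: "card {1..l} = l" by simp
  have "card (SIGMA A:?K. {1..l} - A) \<le> card (SIGMA X:I. X)"
  proof (rule card_inj_on_le[where f = ?g])
    show "inj_on ?g (SIGMA A:?K. {1..l} - A)"
    proof (rule inj_onI, clarsimp)
      fix A B x assume h: "A \<in> ?K" "B \<in> ?K" "x \<notin> A" "x \<notin> B"
        and e: "insert x (A - {l}) = insert x (B - {l})"
      have "A - {l} = B - {l}" using e h by (metis Diff_iff insert_ident)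
      moreover have "l \<in> A" "l \<in> B" using h by (auto simp: critical_def)
      ultimately show "A = B" by (metis insert_Diff)
    qed
    show "?g ` (SIGMA A:?K. {1..l} - A) \<subseteq> (SIGMA X:I. X)"
    proof clarify
      fix A x assume A: "A \<in> ?K" and x: "x \<in> {1..l}" "x \<notin> A"
      hence "x \<in> {1..l} - A" by simp
      from critical_shift[OF A this]
      show "insert x (A - {l}) \<in> I \<and> x \<in> insert x (A - {l})" unfolding I_def by simp
    qed
    show "finite (SIGMA X:I. X)"
      using fI memA unfolding I_def by (intro finite_SigmaI) auto
  qed
  moreover have "card (SIGMA A:?K. {1..l} - A) = (\<Sum>A\<in>?K. card ({1..l} - A))"
    using fK by (subst card_SigmaI) auto
  moreover have "(\<Sum>A\<in>?K. card ({1..l} - A)) = (\<Sum>A\<in>?K. l - i)"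
  proof (rule sum.cong[OF refl])
    fix A assume "A \<in> ?K"
    hence "A \<in> \<A>" "card A = i" by (auto simp: critical_def)
    thus "card ({1..l} - A) = l - i" using memA[of A] by (simp add: card_Diff_subset)
  qed
  moreover have "card (SIGMA X:I. X) = (\<Sum>X\<in>I. card X)"
    using fI memA unfolding I_def by (subst card_SigmaI) auto
  moreover have "(\<Sum>X\<in>I. card X) = (\<Sum>X\<in>I. i)" by (rule sum.cong) (auto simp: I_def)
  ultimately have "card ?K * (l - i) \<le> card I * i" by simp
  hence c: "real (card ?K) * real (l - i) \<le> real (card I) * real i"
    by (metis of_nat_le_iff of_nat_mult)
  show ?thesis
  proof (cases "?K = {}")
    case True
    thus ?thesis using W_pos by (simp add: weight_def)
  next
    case False
    then obtain A where "A \<in> \<A>" "card A = i" by (auto simp: critical_def)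
    hence "i \<le> l" using memA by blast
    hence c': "real l * card ?K \<le> i * (card ?K + card I)"
      using c by (simp add: of_nat_diff algebra_simps)
    have "card ?K * w i + card I * w i = weight w (?K \<union> I)"
    proof -
      have "weight w (?K \<union> I) = weight w ?K + weight w I"
        unfolding weight_def by (rule sum.union_disjoint) (use fK fI in \<open>auto simp: I_def critical_def\<close>)
      moreover have "weight w I = card I * w i" unfolding weight_def by (simp add: I_def)
      ultimately show ?thesis by (simp add: weight_critical)
    qed
    also have "\<dots> \<le> weight w \<A>" by (rule weight_sub_mono) (auto simp: I_def critical_def)
    finally have "(card ?K + real (card I)) * w i \<le> weight w \<A>" by (simp add: algebra_simps)
    hence "i * ((card ?K + real (card I)) * w i) \<le> i * weight w \<A>" by (rule mult_left_mono) simp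
    moreover have "(real l * card ?K) * w i \<le> (i * (card ?K + real (card I))) * w i"
      using c' by (intro mult_right_mono w_nonneg) simp
    ultimately show ?thesis by (simp add: weight_critical mult.assoc)
  qed
qed

text \<open>
  A critical set of size \<open>t\<close> lies in all members of the other family, which is therefore \<open>{{1..l}}\<close>, so
  that \<open>b = 1\<close> in the notation of the introduction. The inequalities then leave only \<open>l = t + 1\<close> and
  \<open>lam = t\<close>, where the weights can be compared explicitly.
\<close>
lemma critical_size_t:
  assumes A: "A \<in> critical l \<A> t" and tl: "t < l"
  shows "weight w \<A> * weight v \<B> \<le> weight w (fixing t l) * weight v (fixing t l) \<and> lam = t"
proof -
  interpret sw: optimal_pair t l lam v w \<B> \<A> by (rule swap)
  have A': "A \<in> \<A>" "l \<in> A" "card A = t" using A by (auto simp: critical_def)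
  have fA: "finite A" using memA[OF A'(1)] by simp
  have "B = {1..l}" if B: "B \<in> \<B>" for B
  proof (rule ccontr)
    assume n: "B \<noteq> {1..l}"
    have sB: "B \<subseteq> {1..l}" using sw.memA[OF B] by auto
    have "card B \<noteq> l" using card_subset_eq[OF _ sB] n by auto
    have le: "card (A \<inter> B) \<le> t" using A'(3) card_mono[OF fA, of "A \<inter> B"] by auto
    hence "card (A \<inter> B) = card A" using crossD[OF crossAB A'(1) B] A'(3) by simp
    hence "A \<inter> B = A" by (intro card_subset_eq fA) auto
    hence "l \<in> B" using A' by auto
    from cross_Suc[OF A'(1,2) B this] \<open>card B \<noteq> l\<close> A'(3) le show False by simp
  qed
  hence B1: "\<B> = {{1..l}}" using neB by blast
  have "l \<in> {1..l}" using tl by simp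
  hence "{1..l} - {l} \<noteq> {1..l}" by blast
  hence B2: "critical l \<B> l = \<B>" unfolding critical_def B1 using tl by auto
  let ?P = "weight w (critical l \<A> t)"
  have "lam * weight v \<B> * (weight w \<A> - ?P) \<le> weight v \<B> * ?P"
    using sw.alteration[of l t] tl unfolding B2 by simp
  hence "weight v \<B> * (lam * (weight w \<A> - ?P)) \<le> weight v \<B> * ?P" by (simp add: algebra_simps)
  hence 1: "lam * (weight w \<A> - ?P) \<le> ?P" using V_pos by simp
  have 2: "l * ?P \<le> t * weight w \<A>" by (rule critical_fraction)
  have "(lam * (real l - t)) * weight w \<A> \<le> lam * (l * (weight w \<A> - ?P))"
    using mult_left_mono[OF 2, of lam] lam_gt2 by (simp add: algebra_simps)
  also have "\<dots> \<le> l * ?P" using mult_left_mono[OF 1, of "real l"] by (simp add: algebra_simps)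
  also have "\<dots> \<le> t * weight w \<A>" by (rule 2)
  finally have 3: "lam * (real l - t) \<le> t" using W_pos by simp
  have ltt: "l = Suc t"
  proof (rule ccontr)
    assume "l \<noteq> Suc t"
    hence "real l - t \<ge> 2" using tl by linarith
    hence "lam * 2 \<le> lam * (real l - t)" using lam_gt2 by (intro mult_left_mono) auto
    thus False using 3 lam_t lam_gt2 by linarith
  qed
  hence lt: "lam = t" using 3 lam_t by simp
  have V: "weight v \<B> = v (Suc t)" by (simp add: B1 weight_def ltt)
  have W: "weight w \<A> \<le> (t + 1) * w t + w (Suc t)"
    using weight_large_sets[OF subA _ w_nonneg] memA ltt by fastforce
  have r: "t * v (Suc t) \<le> v t" using v_ratio[of t] lt by simp
  have "weight w \<A> * weight v \<B> \<le> ((t + 1) * w t + w (Suc t)) * v (Suc t)"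
    unfolding V by (rule mult_right_mono[OF W v_nonneg])
  also have "\<dots> \<le> ((t + 1) * (w t + w (Suc t))) * v (Suc t)"
    using w_nonneg[of "Suc t"] by (intro mult_right_mono v_nonneg) (simp add: algebra_simps)
  also have "\<dots> = (w t + w (Suc t)) * (t * v (Suc t) + v (Suc t))" by (simp add: algebra_simps)
  also have "\<dots> \<le> (w t + w (Suc t)) * (v t + v (Suc t))"
    using r w_nonneg by (intro mult_left_mono) (auto intro: add_nonneg_nonneg)
  finally show ?thesis using lt unfolding ltt by (simp add: weight_fixing_Suc weight_fixing_self)
qed

text \<open>
  Critical sets of size \<open>l - 1\<close> are complements of single points. For \<open>l = t + 2\<close> this is the size \<open>t + 1\<close>,
  for which \<open>i / l\<close> is too weak a bound on the critical fraction.
\<close>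
lemma critical_missing_one:
  assumes "Suc i = l"
  shows "critical l \<A> i \<subseteq> (\<lambda>m. {1..l} - {m}) ` {1..i}"
proof
  fix A assume "A \<in> critical l \<A> i"
  hence A: "A \<in> \<A>" "l \<in> A" "card A = i" by (auto simp: critical_def)
  have s: "A \<subseteq> {1..l}" using memA A by auto
  have "A \<noteq> {1..l}"
  proof
    assume "A = {1..l}"
    hence "card A = l" by simp
    thus False using A assms by simp
  qed
  then obtain m where m: "m \<in> {1..l}" "m \<notin> A" using s by blast
  hence "m \<noteq> l" using A by auto
  have "A = {1..l} - {m}" using s m A assms by (intro card_seteq) auto
  thus "A \<in> (\<lambda>m. {1..l} - {m}) ` {1..i}" using m \<open>m \<noteq> l\<close> assms by auto
qed

lemma initial_segment_mem:
  assumes "Suc i = l" "A \<in> critical l \<A> i"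
  shows "{1..i} \<in> \<A>"
proof -
  obtain m where m: "m \<in> {1..i}" "A = {1..l} - {m}" using critical_missing_one[OF assms(1)] assms(2) by auto
  have "insert m (A - {l}) \<in> \<A>" using critical_shift(1)[OF assms(2), of m] m assms(1) by auto
  moreover have "insert m (A - {l}) = {1..i}" using m assms(1) by auto
  ultimately show ?thesis by simp
qed

text \<open>
  Besides the critical sets the family contains \<open>{1..i}\<close>, a shift of any of them. This improves the bound
  \<open>i / l\<close> on the critical fraction to \<open>p / (p + 1)\<close>, where \<open>p\<close> is the number of critical sets.
\<close>
lemma weight_critical_missing_one:
  assumes "Suc i = l" "critical l \<A> i \<noteq> {}"
  shows "(real (card (critical l \<A> i)) + 1) * w i \<le> weight w \<A>"
proof -
  let ?K = "critical l \<A> i"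
  obtain A where "A \<in> ?K" using assms by auto
  hence s: "{1..i} \<in> \<A>" by (rule initial_segment_mem[OF assms(1)])
  have "{1..i} \<notin> ?K" using assms(1) by (auto simp: critical_def)
  moreover have "finite ?K" using finA critical_subset finite_subset by metis
  ultimately have "weight w (insert {1..i} ?K) = w i + weight w ?K" unfolding weight_def by simp
  moreover have "weight w (insert {1..i} ?K) \<le> weight w \<A>"
    using s critical_subset by (intro weight_sub_mono) auto
  ultimately show ?thesis by (simp add: weight_critical algebra_simps)
qed

lemma large_if_all_missing_one:
  assumes all: "\<And>m. m \<in> {1..l} \<Longrightarrow> {1..l} - {m} \<in> \<B>" and A: "A \<in> \<A>"
  shows "Suc t \<le> card A"
proof (rule ccontr)
  assume "\<not> ?thesis"
  hence c: "card A = t" using memA[OF A] by simp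
  then obtain z where z: "z \<in> A" using t_pos by fastforce
  have "A \<inter> ({1..l} - {z}) = A - {z}" using memA[OF A] by auto
  moreover have "t \<le> card (A \<inter> ({1..l} - {z}))"
    using crossD[OF crossAB A all, of z] memA[OF A] z by auto
  ultimately show False using c z t_pos memA[OF A] by simp
qed

lemma weight_less_fixing:
  assumes l: "l = t + 2" and large: "\<And>A. A \<in> \<A> \<Longrightarrow> Suc t \<le> card A"
  shows "weight w \<A> \<le> weight w (fixing t l)" "t < lam \<Longrightarrow> 0 < w (Suc t) \<Longrightarrow> weight w \<A> < weight w (fixing t l)"
proof -
  have 1: "weight w \<A> \<le> (t + 2) * w (Suc t) + w (Suc (Suc t))"
    using weight_large_sets[OF subA _ w_nonneg] large l by force
  have 2: "weight w (fixing t l) = w t + w (Suc t) + (w (Suc t) + w (Suc (Suc t)))"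
    unfolding l by (simp add: weight_fixing_Suc weight_fixing_self)
  have 3: "lam * w (Suc t) \<le> w t" by (rule w_ratio) simp
  have 4: "t * w (Suc t) \<le> lam * w (Suc t)" by (intro mult_right_mono lam_t w_nonneg)
  show "weight w \<A> \<le> weight w (fixing t l)" using 1 2 3 4 by (simp add: algebra_simps)
  assume "t < lam" "0 < w (Suc t)"
  hence "t * w (Suc t) < lam * w (Suc t)" by simp
  thus "weight w \<A> < weight w (fixing t l)" using 1 2 3 by (simp add: algebra_simps)
qed

lemma opt_fixing: "weight w (fixing t l) * weight v (fixing t l) \<le> weight w \<A> * weight v \<B>"
  by (rule opt[OF _ _ cross_fixing[OF t_le_l]]) (auto simp: fixing_def)

lemma critical_disjoint_False:
  assumes l: "l = t + 2" and K: "critical l \<A> (Suc t) \<noteq> {}" and L: "critical l \<B> (Suc t) \<noteq> {}"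
    and small: "real (card (critical l \<A> (Suc t))) + 1 < lam"
  shows False
proof -
  interpret sw: optimal_pair t l lam v w \<B> \<A> by (rule swap)
  let ?K = "critical l \<A> (Suc t)" and ?L = "critical l \<B> (Suc t)"
  let ?p = "real (card ?K)"
  have fin: "finite ?K" "finite ?L" using finA finB critical_subset finite_subset by metis+
  obtain A B where AB: "A \<in> ?K" "B \<in> ?L" using K L by auto
  hence wp: "0 < w (Suc t)" "0 < v (Suc t)" using posA[of A] posB[of B] by (auto simp: critical_def)
  have pos: "0 < weight w ?K" "0 < weight v ?L" using wp fin K L by (auto simp: weight_critical card_gt_0_iff)
  have W: "(?p + 1) * w (Suc t) \<le> weight w \<A>" by (rule weight_critical_missing_one) (use l K in auto)
  have "(?p + 1) * w (Suc t) < lam * w (Suc t)" using small wp by simp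
  have d: "w (Suc t) \<le> weight w \<A> - weight w ?K" using W by (simp add: weight_critical algebra_simps)
  have "weight w \<A> \<le> (?p + 1) * (weight w \<A> - weight w ?K)"
    using mult_left_mono[OF d, of ?p] by (simp add: weight_critical algebra_simps)
  also have "\<dots> < lam * (weight w \<A> - weight w ?K)"
    using small d wp by (intro mult_strict_right_mono) auto
  finally show False
    using ratio_contradiction[OF W_pos V_pos pos, of lam] alteration[of "Suc t" "Suc t"]
      sw.alteration[of "Suc t" "Suc t"] lam_gt2 l by simp
qed

text \<open>
  If \<open>A0\<close> is critical in both families, delete all other critical sets from both and add \<open>A0 - {l}\<close> to both.
  The change of each weight is at least \<open>t + 1 - p\<close> times the weight of a \<open>(t + 1)\<close>-set, \<open>p\<close> being the number
  of critical sets. As \<open>p \<le> t + 1\<close>, optimality forces \<open>p = t + 1\<close> on both sides.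
\<close>
lemma common_critical_full:
  assumes l: "l = t + 2" and A0: "A0 \<in> critical l \<A> (Suc t)" "A0 \<in> critical l \<B> (Suc t)"
  shows "card (critical l \<A> (Suc t)) = Suc t \<and> card (critical l \<B> (Suc t)) = Suc t"
proof (rule ccontr)
  interpret sw: optimal_pair t l lam v w \<B> \<A> by (rule swap)
  let ?K = "critical l \<A> (Suc t)" and ?L = "critical l \<B> (Suc t)"
  assume n: "\<not> ?thesis"
  have fin: "finite ?K" "finite ?L" using finA finB critical_subset finite_subset by metis+
  have cK: "card ?K \<le> Suc t" "card ?L \<le> Suc t"
    using surj_card_le[OF _ critical_missing_one[of "Suc t"]] surj_card_le[OF _ sw.critical_missing_one[of "Suc t"]] l by auto
  have wp: "0 < w (Suc t)" "0 < v (Suc t)" using posA[of A0] posB[of A0] A0 by (auto simp: critical_def)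
  define C where "C = insert (A0 - {l}) (\<A> - (?K - {A0}))"
  define D where "D = insert (A0 - {l}) (\<B> - (?L - {A0}))"
  have A0': "A0 \<in> \<A>" "A0 \<in> \<B>" "l \<in> A0" "A0 - {l} \<notin> \<A>" "A0 - {l} \<notin> \<B>" "card A0 = Suc t"
    using A0 by (auto simp: critical_def)
  have c0: "card (A0 - {l}) = t" using A0' by simp
  have 1: "t \<le> card ((A0 - {l}) \<inter> B)" if "B \<in> \<B> - (?L - {A0})" for B
  proof (cases "B = A0")
    case True thus ?thesis using c0 by (simp add: Int_absorb2 Diff_subset)
  next
    case False
    thus ?thesis using remove_last[OF A0'(1,3), of B] that A0'(6) l by auto
  qed
  have 2: "t \<le> card (A \<inter> (A0 - {l}))" if "A \<in> \<A> - (?K - {A0})" for A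
  proof (cases "A = A0")
    case True thus ?thesis using c0 by (simp add: Int_absorb1 Diff_subset)
  next
    case False
    thus ?thesis using sw.remove_last[OF A0'(2,3), of A] that A0'(6) l by (auto simp: Int_commute)
  qed
  have "cross t C D"
    unfolding cross_def C_def D_def using 1 2 c0 crossD[OF crossAB] by auto
  moreover have "C \<subseteq> Pow {1..l}" "D \<subseteq> Pow {1..l}" using subA subB A0'(1) unfolding C_def D_def by auto
  ultimately have o: "weight w C * weight v D \<le> weight w \<A> * weight v \<B>" using opt by blast
  have general: "weight f (insert (A0 - {l}) (\<F> - (critical l \<F> (Suc t) - {A0}))) =
      weight f \<F> + f t - (real (card (critical l \<F> (Suc t))) - 1) * f (Suc t)"
    if "finite \<F>" "A0 \<in> critical l \<F> (Suc t)" for \<F> f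
  proof -
    let ?M = "critical l \<F> (Suc t)"
    have fM: "finite ?M" using that critical_subset finite_subset by metis
    have "A0 - {l} \<notin> \<F>" using that by (auto simp: critical_def)
    hence "weight f (insert (A0 - {l}) (\<F> - (?M - {A0}))) = f t + weight f (\<F> - (?M - {A0}))"
      unfolding weight_def using that c0 by (subst sum.insert) auto
    also have "weight f (\<F> - (?M - {A0})) = weight f \<F> - weight f (?M - {A0})"
      unfolding weight_def using that critical_subset[of l \<F>] by (intro sum_diff) auto
    also have "weight f (?M - {A0}) = weight f ?M - f (Suc t)"
      unfolding weight_def using that fM A0'(6) by (simp add: sum_diff1)
    finally show ?thesis by (simp add: weight_critical algebra_simps)
  qed
  have wC: "weight w C = weight w \<A> + w t - (real (card ?K) - 1) * w (Suc t)"
    unfolding C_def by (rule general[OF finA A0(1)])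
  have wD: "weight v D = weight v \<B> + v t - (real (card ?L) - 1) * v (Suc t)"
    unfolding D_def by (rule general[OF finB A0(2)])
  have r: "t * w (Suc t) \<le> w t" "t * v (Suc t) \<le> v t"
    using w_ratio[of t] v_ratio[of t] mult_right_mono[OF lam_t w_nonneg[of "Suc t"]]
      mult_right_mono[OF lam_t v_nonneg[of "Suc t"]] by auto
  have C1: "weight w C \<ge> weight w \<A> + (real (Suc t) - card ?K) * w (Suc t)"
    using wC r by (simp add: algebra_simps)
  have D1: "weight v D \<ge> weight v \<B> + (real (Suc t) - card ?L) * v (Suc t)"
    using wD r by (simp add: algebra_simps)
  have nn: "0 \<le> (real (Suc t) - card ?K) * w (Suc t)" "0 \<le> (real (Suc t) - card ?L) * v (Suc t)"
    using cK wp by (auto intro!: mult_nonneg_nonneg)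
  consider "card ?K < Suc t" | "card ?L < Suc t" using n cK by linarith
  thus False
  proof cases
    case 1
    hence "0 < (real (Suc t) - card ?K) * w (Suc t)" using wp by simp
    hence "weight w \<A> < weight w C" using C1 by linarith
    moreover have "weight v \<B> \<le> weight v D" using D1 nn by linarith
    ultimately have "weight w \<A> * weight v \<B> < weight w C * weight v D"
      using W_pos V_pos by (intro mult_less_le_imp_less) auto
    thus False using o by simp
  next
    case 2
    hence "0 < (real (Suc t) - card ?L) * v (Suc t)" using wp by simp
    hence "weight v \<B> < weight v D" using D1 by linarith
    moreover have "weight w \<A> \<le> weight w C" using C1 nn by linarith
    ultimately have "weight w \<A> * weight v \<B> < weight w C * weight v D"
      using W_pos V_pos by (intro mult_le_less_imp_less) auto
    thus False using o by simp
  qed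
qed

lemma all_missing_one:
  assumes l: "l = t + 2" and "card (critical l \<A> (Suc t)) = Suc t" and m: "m \<in> {1..l}"
  shows "{1..l} - {m} \<in> \<A>"
proof (cases "m = l")
  case True
  have "critical l \<A> (Suc t) \<noteq> {}" using assms(2) by (metis card.empty nat.simps(3))
  then obtain A where "A \<in> critical l \<A> (Suc t)" by blast
  have "Suc (Suc t) = l" using l by simp
  from initial_segment_mem[OF this \<open>A \<in> _\<close>] have "{1..Suc t} \<in> \<A>" .
  moreover have "{1..l} - {m} = {1..Suc t}" using True l by auto
  ultimately show ?thesis by simp
next
  case False
  let ?I = "(\<lambda>m. {1..l} - {m}) ` {1..Suc t}"
  have "card ?I \<le> Suc t" using card_image_le[of "{1..Suc t}" "\<lambda>m. {1..l} - {m}"] by simp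
  moreover have "critical l \<A> (Suc t) \<subseteq> ?I" by (rule critical_missing_one) (simp add: l)
  ultimately have "critical l \<A> (Suc t) = ?I" using assms(2) by (intro card_seteq) simp_all
  moreover have "{1..l} - {m} \<in> ?I" using m False l by (intro imageI) simp
  ultimately have "{1..l} - {m} \<in> critical l \<A> (Suc t)" by (simp only:)
  thus ?thesis by (rule subsetD[OF critical_subset])
qed

text \<open>
  Both families have at most \<open>t + 1\<close> critical sets, all complements of points. If no set is critical in both,
  there are at most \<open>t + 1\<close> altogether, and one of the two families has fewer than \<open>lam - 1\<close> of them, which
  contradicts optimality. If some set is critical in both, all complements of points belong to both families,
  so that all members have at least \<open>t + 1\<close> elements.
\<close>
lemma critical_size_Suc_t:
  assumes l: "l = t + 2" and K: "critical l \<A> (Suc t) \<noteq> {}" and L: "critical l \<B> (Suc t) \<noteq> {}"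
  shows "weight w \<A> * weight v \<B> \<le> weight w (fixing t l) * weight v (fixing t l) \<and> lam = t"
proof (cases "critical l \<A> (Suc t) \<inter> critical l \<B> (Suc t) = {}")
  case True
  interpret sw: optimal_pair t l lam v w \<B> \<A> by (rule swap)
  let ?K = "critical l \<A> (Suc t)" and ?L = "critical l \<B> (Suc t)"
  have fin: "finite ?K" "finite ?L" using finA finB critical_subset finite_subset by metis+
  have "card (?K \<union> ?L) \<le> card {1..Suc t}"
    by (rule surj_card_le[where f = "\<lambda>m. {1..l} - {m}"])
       (use critical_missing_one[of "Suc t"] sw.critical_missing_one[of "Suc t"] l in auto)
  hence "card ?K + card ?L \<le> Suc t" using card_Un_disjoint[OF fin True] by simp
  hence "real (card ?K) + real (card ?L) \<le> real t + 1" by linarith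
  hence "\<not> (lam \<le> real (card ?K) + 1 \<and> lam \<le> real (card ?L) + 1)" using lam_big by auto
  hence "real (card ?K) + 1 < lam \<or> real (card ?L) + 1 < lam" by auto
  thus ?thesis using critical_disjoint_False[OF l K L] sw.critical_disjoint_False[OF l L K] by auto
next
  case False
  interpret sw: optimal_pair t l lam v w \<B> \<A> by (rule swap)
  from False obtain A0 where A0: "A0 \<in> critical l \<A> (Suc t)" "A0 \<in> critical l \<B> (Suc t)" by auto
  have wp: "0 < w (Suc t)" "0 < v (Suc t)" using posA[of A0] posB[of A0] A0 by (auto simp: critical_def)
  note full = common_critical_full[OF l A0]
  have lA: "\<And>A. A \<in> \<A> \<Longrightarrow> Suc t \<le> card A"
    using large_if_all_missing_one sw.all_missing_one[OF l] full by blast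
  have lB: "\<And>B. B \<in> \<B> \<Longrightarrow> Suc t \<le> card B"
    using sw.large_if_all_missing_one all_missing_one[OF l] full by blast
  note A = weight_less_fixing[OF l lA] and B = sw.weight_less_fixing[OF l lB]
  have "weight w \<A> * weight v \<B> \<le> weight w (fixing t l) * weight v (fixing t l)"
    using A(1) B(1) W_pos V_pos by (intro mult_mono) auto
  moreover have "\<not> t < lam"
  proof
    assume "t < lam"
    hence "weight w \<A> * weight v \<B> < weight w (fixing t l) * weight v (fixing t l)"
      using A(2) B(2) wp W_pos V_pos by (intro mult_strict_mono) auto
    thus False using opt_fixing by simp
  qed
  ultimately show ?thesis using lam_t by simp
qed

lemma last_removable:
  assumes tl: "t < l" and A: "A \<in> \<A>" "l \<in> A" "A - {l} \<notin> \<A>"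
  shows "weight w \<A> * weight v \<B> \<le> weight w (fixing t l) * weight v (fixing t l) \<and> lam = t"
proof -
  interpret sw: optimal_pair t l lam v w \<B> \<A> by (rule swap)
  define i where "i = card A"
  have it: "t \<le> i" "i \<le> l" using memA[OF A(1)] by (auto simp: i_def)
  define j where "j = l + t - i"
  have ij: "i + j = l + t" "j + i = l + t" using it unfolding j_def by auto
  let ?K = "critical l \<A> i" and ?L = "critical l \<B> j"
  have fin: "finite ?K" "finite ?L" using finA finB critical_subset finite_subset by metis+
  have AK: "A \<in> ?K" using A by (simp add: critical_def i_def)
  have wi: "0 < w i" using posA[OF A(1)] i_def by simp
  have "?K \<noteq> {}" using AK by auto
  hence "0 < card ?K" using fin by (simp add: card_gt_0_iff)
  hence P: "0 < weight w ?K" using wi by (simp add: weight_critical)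
  show ?thesis
  proof (cases "i = t")
    case True thus ?thesis using critical_size_t[OF _ tl] AK by simp
  next
    case False
    hence ti: "t < i" using it by simp
    note a1 = alteration[OF ij(1) ti]
    have Q: "0 < weight v ?L"
    proof (rule ccontr)
      assume "\<not> ?thesis"
      moreover have "0 \<le> weight v ?L" unfolding weight_def by (intro sum_nonneg v_nonneg)
      ultimately have "weight v ?L = 0" by simp
      hence "lam * weight w ?K * weight v \<B> \<le> 0" using a1 by simp
      moreover have "0 < lam * weight w ?K * weight v \<B>" using P V_pos lam_gt2 by simp
      ultimately show False by simp
    qed
    hence Lne: "?L \<noteq> {}" by (auto simp: weight_def)
    show ?thesis
    proof (cases "j = t")
      case True
      then obtain B where "B \<in> critical l \<B> t" using Lne by auto
      from sw.critical_size_t[OF this tl] show ?thesis by (simp add: mult.commute)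
    next
      case False
      have tj: "t < j" using False it ij by simp
      note a2 = sw.alteration[OF ij(2) tj]
      show ?thesis
      proof (cases "i = Suc t \<and> j = Suc t")
        case True
        thus ?thesis using critical_size_Suc_t Lne AK ij by auto
      next
        case nb: False
        \<comment> \<open>The larger of \<open>i\<close> and \<open>j\<close> exceeds \<open>t\<close> by at least 2, which is where \<open>lam > (t + 4) / 2\<close> is needed:
          the smaller one then satisfies \<open>i / l < 1 - 1 / lam\<close>.\<close>
        have key: "lam * (real l - i) > l" if "i \<le> j" "j \<noteq> Suc t" "t < i" "i + j = l + t" for i j :: nat
        proof -
          define c where "c = i - t"
          define c' where "c' = j - t"
          have c: "i = t + c" and cc: "c \<le> c'" "2 \<le> c'" "l = t + c + c'"
            using that by (auto simp: c_def c'_def)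
          have "real t < 2 * (lam - 2)" using lam_big by simp
          also have "\<dots> \<le> c' * (lam - 2)" using cc lam_gt2 by (intro mult_right_mono) auto
          finally have "real t + 2 * c' < lam * c'" by (simp add: algebra_simps)
          moreover have "real l - i = c'" using c cc by simp
          moreover have "real l \<le> real t + 2 * c'" using cc by simp
          ultimately show ?thesis by simp
        qed
        show ?thesis
        proof (cases "i \<le> j")
          case True
          have "real l * weight w \<A> < lam * (real l - i) * weight w \<A>"
            using key[OF True _ ti ij(1)] nb True ti W_pos by force
          also have "\<dots> \<le> lam * (l * (weight w \<A> - weight w ?K))"
            using mult_left_mono[OF critical_fraction[of i], of lam] lam_gt2 by (simp add: algebra_simps)
          finally have "l * weight w \<A> < l * (lam * (weight w \<A> - weight w ?K))" by (simp add: algebra_simps)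
          hence "weight w \<A> < lam * (weight w \<A> - weight w ?K)" using tl by simp
          from ratio_contradiction[OF W_pos V_pos P Q _ a1 a2 this] show ?thesis using lam_gt2 by simp
        next
          case False
          have "real l * weight v \<B> < lam * (real l - j) * weight v \<B>"
            using key[OF _ _ tj ij(2)] nb False tj V_pos by force
          also have "\<dots> \<le> lam * (l * (weight v \<B> - weight v ?L))"
            using mult_left_mono[OF sw.critical_fraction[of j], of lam] lam_gt2 by (simp add: algebra_simps)
          finally have "l * weight v \<B> < l * (lam * (weight v \<B> - weight v ?L))" by (simp add: algebra_simps)
          hence "weight v \<B> < lam * (weight v \<B> - weight v ?L)" using tl by simp
          from ratio_contradiction[OF V_pos W_pos Q P _ a2 a1 this] show ?thesis using lam_gt2 by simp
        qed
      qed
    qed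
  qed
qed

end

section \<open>The weighted problem: induction on the ground set\<close>

lemma cross_double:
  assumes C: "\<C> \<subseteq> Pow {1..l}" and c: "cross t \<C> \<D>"
  shows "cross t (\<C> \<union> insert (Suc l) ` \<C>) (\<D> \<union> insert (Suc l) ` \<D>)"
  unfolding cross_def
proof (intro ballI)
  fix X Y assume "X \<in> \<C> \<union> insert (Suc l) ` \<C>" "Y \<in> \<D> \<union> insert (Suc l) ` \<D>"
  then obtain X0 Y0 where 1: "X0 \<in> \<C>" "X = X0 \<or> X = insert (Suc l) X0" "Y0 \<in> \<D>" "Y = Y0 \<or> Y = insert (Suc l) Y0"
    by auto
  have "finite X0" using 1 C by (auto intro: finite_subset)
  hence "finite X" using 1 by auto
  hence "card (X0 \<inter> Y0) \<le> card (X \<inter> Y)" using 1 by (intro card_mono) auto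
  thus "t \<le> card (X \<inter> Y)" using crossD[OF c 1(1,3)] by simp
qed

lemma double_subset:
  assumes "\<C> \<subseteq> Pow {1..l}"
  shows "\<C> \<union> insert (Suc l) ` \<C> \<subseteq> Pow {1..Suc l}"
proof -
  have "X \<subseteq> {1..Suc l} \<and> insert (Suc l) X \<subseteq> {1..Suc l}" if "X \<in> \<C>" for X
  proof -
    have "X \<subseteq> {1..l}" using that assms by auto
    thus ?thesis by (auto simp: atLeastAtMostSuc_conv)
  qed
  thus ?thesis by auto
qed

lemma drop_last:
  assumes \<A>: "\<A> \<subseteq> Pow {1..Suc l}" and rem: "\<And>A. A \<in> \<A> \<Longrightarrow> Suc l \<in> A \<Longrightarrow> A - {Suc l} \<in> \<A>"
    and ne: "\<A> \<noteq> {}" and compr: "compressed \<A>"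
    and w: "\<And>a. 0 \<le> w a" and pos: "\<And>A. A \<in> \<A> \<Longrightarrow> 0 < w (card A)"
  defines "\<A>' \<equiv> {A \<in> \<A>. Suc l \<notin> A}" and "w' \<equiv> \<lambda>a. w a + w (Suc a)"
  shows "\<A>' \<subseteq> Pow {1..l}" "\<A>' \<noteq> {}" "compressed \<A>'" "\<And>A. A \<in> \<A>' \<Longrightarrow> 0 < w' (card A)"
    "weight w \<A> \<le> weight w' \<A>'" "\<And>A. A \<in> \<A> \<Longrightarrow> A - {Suc l} \<in> \<A>'"
proof -
  show s: "\<A>' \<subseteq> Pow {1..l}"
  proof
    fix X assume "X \<in> \<A>'"
    hence "X \<subseteq> {1..Suc l}" "Suc l \<notin> X" using \<A> by (auto simp: \<A>'_def)
    moreover have "{1..Suc l} = insert (Suc l) {1..l}" by auto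
    ultimately show "X \<in> Pow {1..l}" by auto
  qed
  show r: "\<And>A. A \<in> \<A> \<Longrightarrow> A - {Suc l} \<in> \<A>'"
    unfolding \<A>'_def using rem by (case_tac "Suc l \<in> A") auto
  thus "\<A>' \<noteq> {}" using ne by auto
  show "compressed \<A>'"
    unfolding compressed_def
  proof (intro ballI allI impI)
    fix A x y assume h: "A \<in> \<A>'" "0 < x" "x < y" "y \<in> A" "x \<notin> A"
    have "A \<subseteq> {1..l}" using h s by auto
    hence "y \<le> l" using h by auto
    hence "x \<noteq> Suc l" using h by simp
    thus "insert x (A - {y}) \<in> \<A>'" using h compressedD[OF compr, of A x y] unfolding \<A>'_def by auto
  qed
  show "\<And>A. A \<in> \<A>' \<Longrightarrow> 0 < w' (card A)"
    unfolding w'_def \<A>'_def using pos w by (simp add: add_pos_nonneg)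
  have "\<A> \<subseteq> \<A>' \<union> insert (Suc l) ` \<A>'"
  proof
    fix A assume "A \<in> \<A>"
    thus "A \<in> \<A>' \<union> insert (Suc l) ` \<A>'"
      using r[of A] by (cases "Suc l \<in> A") (auto simp: image_iff insert_absorb \<A>'_def)
  qed
  hence "weight w \<A> \<le> weight w (\<A>' \<union> insert (Suc l) ` \<A>')"
    using finite_sub_Pow[OF s] w by (intro weight_mono) auto
  thus "weight w \<A> \<le> weight w' \<A>'" unfolding weight_double[OF s] w'_def .
qed

text \<open>
  When \<open>l\<close> can be removed from all members, the traces on \<open>{1..l - 1}\<close> form an optimal pair for the weights
  \<open>w a + w (Suc a)\<close>: a competing pair there becomes a competing pair on \<open>{1..l}\<close> of the same weight by
  doubling. A critical set can occur only for \<open>lam = t\<close>, and then the bound has been shown directly.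
\<close>
lemma optimal_pair_fixing:
  "optimal_pair t l lam w v \<A> \<B> \<Longrightarrow>
    weight w \<A> * weight v \<B> \<le> weight w (fixing t l) * weight v (fixing t l) \<and>
    (t < lam \<longrightarrow> (\<forall>A\<in>\<A> \<union> \<B>. {1..t} \<subseteq> A))"
proof (induction l arbitrary: w v \<A> \<B>)
  case 0
  interpret optimal_pair t 0 lam w v \<A> \<B> by fact
  show ?case using t_pos t_le_l by simp
next
  case (Suc l)
  interpret optimal_pair t "Suc l" lam w v \<A> \<B> by fact
  interpret sw: optimal_pair t "Suc l" lam v w \<B> \<A> by (rule swap)
  show ?case
  proof (cases "t = Suc l")
    case True
    have 1: "A = {1..t}" if "A \<in> \<A>" for A
      using memA[OF that] True by (intro card_seteq) auto
    have 2: "B = {1..t}" if "B \<in> \<B>" for B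
      using sw.memA[OF that] True by (intro card_seteq) auto
    have e: "\<A> = fixing t t" "\<B> = fixing t t" unfolding fixing_self using 1 2 neA neB by blast+
    show ?thesis using 1 2 unfolding e True[symmetric] by auto
  next
    case False
    hence tl: "t \<le> l" "t < Suc l" using t_le_l by auto
    show ?thesis
    proof (cases "(\<forall>A\<in>\<A>. Suc l \<in> A \<longrightarrow> A - {Suc l} \<in> \<A>) \<and> (\<forall>A\<in>\<B>. Suc l \<in> A \<longrightarrow> A - {Suc l} \<in> \<B>)")
      case False
      hence "weight w \<A> * weight v \<B> \<le> weight w (fixing t (Suc l)) * weight v (fixing t (Suc l)) \<and> lam = t"
        using last_removable[OF tl(2)] sw.last_removable[OF tl(2)] by (auto simp: mult.commute)
      thus ?thesis by simp
    next
      case True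
      define A' where "A' = {A \<in> \<A>. Suc l \<notin> A}"
      define B' where "B' = {A \<in> \<B>. Suc l \<notin> A}"
      define w' where "w' = (\<lambda>a. w a + w (Suc a))"
      define v' where "v' = (\<lambda>a. v a + v (Suc a))"
      have remA: "\<And>A. A \<in> \<A> \<Longrightarrow> Suc l \<in> A \<Longrightarrow> A - {Suc l} \<in> \<A>"
        and remB: "\<And>A. A \<in> \<B> \<Longrightarrow> Suc l \<in> A \<Longrightarrow> A - {Suc l} \<in> \<B>" using True by auto
      note dA = drop_last[where \<A> = \<A> and w = w and l = l, OF subA remA neA comprA w_nonneg posA, folded A'_def w'_def]
      note dB = drop_last[where \<A> = \<B> and w = v and l = l, OF subB remB neB comprB v_nonneg posB, folded B'_def v'_def]
      have nn: "0 \<le> weight v \<B>" "0 \<le> weight w' A'"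
        unfolding weight_def w'_def using w_nonneg v_nonneg by (auto intro!: sum_nonneg add_nonneg_nonneg)
      have le: "weight w \<A> * weight v \<B> \<le> weight w' A' * weight v' B'"
        by (intro mult_mono dA(5) dB(5) nn)
      have "optimal_pair t l lam w' v' A' B'"
      proof
        show "cross t A' B'" using crossAB unfolding cross_def A'_def B'_def by auto
        show "lam * w' (Suc a) \<le> w' a" if "t \<le> a" for a
          using w_ratio[of a] w_ratio[of "Suc a"] that unfolding w'_def by (simp add: algebra_simps)
        show "lam * v' (Suc a) \<le> v' a" if "t \<le> a" for a
          using v_ratio[of a] v_ratio[of "Suc a"] that unfolding v'_def by (simp add: algebra_simps)
        fix \<C> \<D> assume C: "\<C> \<subseteq> Pow {1..l}" and D: "\<D> \<subseteq> Pow {1..l}" and c: "cross t \<C> \<D>"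
        from opt[OF double_subset[OF C] double_subset[OF D] cross_double[OF C c]] le
        show "weight w' \<C> * weight v' \<D> \<le> weight w' A' * weight v' B'"
          unfolding weight_double[OF C] weight_double[OF D] w'_def v'_def by linarith
      qed (use t_pos tl lam_t lam_big w_nonneg v_nonneg dA dB in \<open>auto simp: w'_def v'_def intro: add_nonneg_nonneg\<close>)
      from Suc.IH[OF this] have IH: "weight w' A' * weight v' B' \<le> weight w' (fixing t l) * weight v' (fixing t l)"
        "t < lam \<Longrightarrow> \<forall>A\<in>A' \<union> B'. {1..t} \<subseteq> A" by auto
      have "weight w \<A> * weight v \<B> \<le> weight w (fixing t (Suc l)) * weight v (fixing t (Suc l))"
        unfolding weight_fixing_Suc[OF tl(1)] using le IH(1) unfolding w'_def v'_def by linarith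
      moreover have "{1..t} \<subseteq> A" if "t < lam" "A \<in> \<A> \<union> \<B>" for A
      proof -
        have "A - {Suc l} \<in> A' \<union> B'" using dA(6) dB(6) that(2) by auto
        hence "{1..t} \<subseteq> A - {Suc l}" by (rule bspec[OF IH(2)[OF that(1)]])
        thus ?thesis by (rule order_trans) auto
      qed
      ultimately show ?thesis by blast
    qed
  qed
qed

section \<open>Uniform families and their traces on an initial segment\<close>

definition star :: "nat \<Rightarrow> nat \<Rightarrow> nat set \<Rightarrow> nat set set" where
  "star m r T = {A \<in> nsets {1..m} r. T \<subseteq> A}"

lemma nsets_iff: "A \<in> nsets X k \<longleftrightarrow> A \<subseteq> X \<and> finite A \<and> card A = k"
  by (simp add: nsets_def)

lemma card_Un_nsets:
  assumes "Y \<inter> Z = {}"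
  shows "card ((\<lambda>S. Y \<union> S) ` nsets Z k) = card Z choose k"
proof -
  have "inj_on (\<lambda>S. Y \<union> S) (nsets Z k)"
    using assms by (intro inj_onI) (simp add: nsets_iff, blast)
  thus ?thesis by (simp add: card_image)
qed

lemma star_eq_image:
  assumes T: "T \<subseteq> {1..m}" "card T \<le> r"
  shows "star m r T = (\<lambda>S. T \<union> S) ` nsets ({1..m} - T) (r - card T)"
proof (intro set_eqI iffI)
  have fT: "finite T" using T finite_subset by blast
  fix A assume "A \<in> star m r T"
  hence A: "A \<subseteq> {1..m}" "finite A" "card A = r" "T \<subseteq> A" by (auto simp: star_def nsets_iff)
  hence "A - T \<in> nsets ({1..m} - T) (r - card T)" using fT by (auto simp: nsets_iff card_Diff_subset)
  moreover have "A = T \<union> (A - T)" using A by auto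
  ultimately show "A \<in> (\<lambda>S. T \<union> S) ` nsets ({1..m} - T) (r - card T)" by (rule rev_image_eqI)
next
  have fT: "finite T" using T finite_subset by blast
  fix A assume "A \<in> (\<lambda>S. T \<union> S) ` nsets ({1..m} - T) (r - card T)"
  then obtain S where "A = T \<union> S" and "S \<in> nsets ({1..m} - T) (r - card T)" by (elim imageE)
  hence S: "A = T \<union> S" "S \<subseteq> {1..m} - T" "finite S" "card S = r - card T" unfolding nsets_iff by simp_all
  have "T \<inter> S = {}" using S(2) by auto
  hence "card A = card T + card S" unfolding S(1) by (rule card_Un_disjoint[OF fT S(3)])
  thus "A \<in> star m r T" using S T fT by (auto simp: star_def nsets_iff)
qed

lemma card_star:
  assumes "T \<subseteq> {1..m}" "card T \<le> r"
  shows "card (star m r T) = (m - card T) choose (r - card T)"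
proof -
  have "finite T" using assms finite_subset by blast
  thus ?thesis unfolding star_eq_image[OF assms] using assms
    by (subst card_Un_nsets) (auto simp: card_Diff_subset)
qed

lemma cross_star: "card T = t \<Longrightarrow> cross t (star m r T) (star n s T)"
  unfolding cross_def
proof (intro ballI)
  fix X Y assume T: "card T = t" and "X \<in> star m r T" "Y \<in> star n s T"
  hence "card T \<le> card (X \<inter> Y)" by (intro card_mono) (auto simp: star_def nsets_iff)
  thus "t \<le> card (X \<inter> Y)" using T by simp
qed

text \<open>
  The number of \<open>r\<close>-subsets of \<open>{1..m}\<close> with a prescribed trace of size \<open>a\<close> on \<open>{1..l}\<close>. The case distinction
  is needed since truncated subtraction would give the value 1 for \<open>a > r\<close>.
\<close>
definition ext_count :: "nat \<Rightarrow> nat \<Rightarrow> nat \<Rightarrow> nat \<Rightarrow> real" where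
  "ext_count m r l a = (if a \<le> r then real ((m - l) choose (r - a)) else 0)"

lemma card_trace_class:
  assumes Y: "Y \<subseteq> {1..l}" and lm: "l \<le> m"
  shows "real (card {X \<in> nsets {1..m} r. X \<inter> {1..l} = Y}) = ext_count m r l (card Y)"
proof -
  have fY: "finite Y" using Y finite_subset by blast
  let ?K = "{X \<in> nsets {1..m} r. X \<inter> {1..l} = Y}"
  show ?thesis
  proof (cases "card Y \<le> r")
    case True
    have "?K = (\<lambda>S. Y \<union> S) ` nsets {Suc l..m} (r - card Y)"
    proof (intro set_eqI iffI)
      fix X assume "X \<in> ?K"
      hence X: "X \<subseteq> {1..m}" "finite X" "card X = r" "X \<inter> {1..l} = Y" by (auto simp: nsets_iff)
      hence "X - Y \<subseteq> {Suc l..m}" by force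
      hence "X - Y \<in> nsets {Suc l..m} (r - card Y)"
        using X fY by (auto simp: nsets_iff card_Diff_subset)
      moreover have "X = Y \<union> (X - Y)" using X by auto
      ultimately show "X \<in> (\<lambda>S. Y \<union> S) ` nsets {Suc l..m} (r - card Y)" by (rule rev_image_eqI)
    next
      fix X assume "X \<in> (\<lambda>S. Y \<union> S) ` nsets {Suc l..m} (r - card Y)"
      then obtain S where "X = Y \<union> S" and "S \<in> nsets {Suc l..m} (r - card Y)" by (elim imageE)
      hence S: "X = Y \<union> S" "S \<subseteq> {Suc l..m}" "finite S" "card S = r - card Y"
        unfolding nsets_iff by simp_all
      have "Y \<inter> S = {}" using S(2) Y by force
      hence "card X = r" using S fY True by (simp add: card_Un_disjoint)
      moreover have "X \<subseteq> {1..m}" using S Y lm by force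
      moreover have "X \<inter> {1..l} = Y" using S Y by force
      ultimately show "X \<in> ?K" using S fY by (simp add: nsets_iff)
    qed
    moreover have "Y \<inter> {Suc l..m} = {}" using Y by force
    ultimately show ?thesis using True by (simp add: card_Un_nsets ext_count_def)
  next
    case False
    have "X \<inter> {1..l} \<noteq> Y" if "X \<in> nsets {1..m} r" for X
    proof
      assume "X \<inter> {1..l} = Y"
      hence "card Y \<le> card X" using that by (intro card_mono) (auto simp: nsets_iff)
      thus False using that False by (simp add: nsets_iff)
    qed
    hence "?K = {}" by blast
    thus ?thesis using False by (simp only: ext_count_def) simp
  qed
qed

definition having_trace :: "nat \<Rightarrow> nat \<Rightarrow> nat \<Rightarrow> nat set set \<Rightarrow> nat set set" where
  "having_trace m r l \<C> = {X \<in> nsets {1..m} r. X \<inter> {1..l} \<in> \<C>}"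

lemma finite_nsets_interval: "finite (nsets {1..m::nat} r)"
  by (simp add: finite_imp_finite_nsets)

lemma card_having_trace:
  assumes C: "\<C> \<subseteq> Pow {1..l}" and lm: "l \<le> m"
  shows "real (card (having_trace m r l \<C>)) = weight (ext_count m r l) \<C>"
proof -
  have "having_trace m r l \<C> = (\<Union>Y\<in>\<C>. {X \<in> nsets {1..m} r. X \<inter> {1..l} = Y})"
    by (auto simp: having_trace_def)
  also have "card \<dots> = (\<Sum>Y\<in>\<C>. card {X \<in> nsets {1..m} r. X \<inter> {1..l} = Y})"
    by (rule card_UN_disjoint) (use finite_sub_Pow[OF C] finite_nsets_interval[of m r] in auto)
  finally have "real (card (having_trace m r l \<C>)) = (\<Sum>Y\<in>\<C>. real (card {X \<in> nsets {1..m} r. X \<inter> {1..l} = Y}))"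
    by simp
  also have "\<dots> = (\<Sum>Y\<in>\<C>. ext_count m r l (card Y))"
    by (rule sum.cong) (use C card_trace_class[OF _ lm] in auto)
  finally show ?thesis by (simp add: weight_def)
qed

text \<open>
  Consecutive binomial coefficients satisfy \<open>(k + 1) * (N choose (k + 1)) = (N - k) * (N choose k)\<close>, so the
  claim amounts to \<open>lam * (k + 1) \<le> N - k\<close> for all \<open>k + 1 \<le> d\<close>, that is, to the case \<open>k + 1 = d\<close>.
\<close>
lemma ext_count_ratio:
  assumes ta: "t \<le> a" and rd: "r - t \<le> d" and lam: "0 \<le> lam"
    and N: "(lam + 1) * d \<le> real (m - l) + 1"
  shows "lam * ext_count m r l (Suc a) \<le> ext_count m r l a"
proof (cases "Suc a \<le> r")
  case False thus ?thesis by (simp add: ext_count_def)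
next
  case True
  define k where "k = r - Suc a"
  have k: "r - a = Suc k" "r - Suc a = k" using True by (auto simp: k_def)
  let ?N = "m - l"
  have "Suc k \<le> d" using k ta rd by linarith
  hence "(lam + 1) * Suc k \<le> (lam + 1) * d" using lam by (intro mult_left_mono) auto
  hence q: "lam * Suc k \<le> real ?N - k" using N by (simp add: algebra_simps)
  have "0 \<le> lam * Suc k" using lam by simp
  hence kN: "k \<le> ?N" using q by linarith
  have "Suc k * (?N choose Suc k) = (?N - k) * (?N choose k)"
    by (simp only: binomial_absorption binomial_absorb_comp)
  hence id: "real (Suc k) * (?N choose Suc k) = (real ?N - k) * (?N choose k)"
    using kN by (metis of_nat_diff of_nat_mult)
  have "(lam * Suc k) * (?N choose k) \<le> (real ?N - k) * (?N choose k)"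
    using q by (intro mult_right_mono) auto
  hence "real (Suc k) * (lam * (?N choose k)) \<le> real (Suc k) * (?N choose Suc k)"
    unfolding id by (simp add: algebra_simps)
  hence "lam * (?N choose k) \<le> (?N choose Suc k)" by (rule mult_left_le_imp_le) simp
  thus ?thesis using True k by (simp add: ext_count_def)
qed

text \<open>
  A common element \<open>y\<close> of \<open>A\<close> and \<open>B\<close> beyond \<open>r + s - t\<close> can be traded in \<open>A\<close> for an element of
  \<open>{1..r + s - t}\<close> outside \<open>A \<union> B\<close>; one exists because \<open>A \<union> B\<close> has at most \<open>r + s - t\<close> elements, one of which
  is \<open>y\<close>. This does not affect the common elements in \<open>{1..r + s - t}\<close>, so repeating it leads to a set that
  meets \<open>B\<close> in these elements only.
\<close>
lemma trace_cross:
  assumes A: "\<A> \<subseteq> nsets {1..m} r" and B: "\<B> \<subseteq> nsets {1..n} s" and c: "cross t \<A> \<B>"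
    and compr: "compressed \<A>"
  shows "A \<in> \<A> \<Longrightarrow> B \<in> \<B> \<Longrightarrow> t \<le> card (A \<inter> B \<inter> {1..r + s - t})"
proof (induction "card (A \<inter> B - {1..r + s - t})" arbitrary: A rule: less_induct)
  case less
  let ?l = "r + s - t"
  have a: "A \<subseteq> {1..m}" "finite A" "card A = r" using subsetD[OF A less.prems(1)] by (simp_all add: nsets_iff)
  have b: "B \<subseteq> {1..n}" "finite B" "card B = s" using subsetD[OF B less.prems(2)] by (simp_all add: nsets_iff)
  have ct: "t \<le> card (A \<inter> B)" using crossD[OF c less.prems] .
  show ?case
  proof (cases "A \<inter> B \<subseteq> {1..?l}")
    case True
    hence "A \<inter> B \<inter> {1..?l} = A \<inter> B" by auto
    thus ?thesis using ct by simp
  next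
    case False
    then obtain y where y: "y \<in> A" "y \<in> B" "y \<notin> {1..?l}" by blast
    have "\<not> {1..?l} \<subseteq> A \<union> B"
    proof
      assume "{1..?l} \<subseteq> A \<union> B"
      hence "card (insert y {1..?l}) \<le> card (A \<union> B)" using a b y by (intro card_mono) auto
      hence "Suc ?l \<le> card (A \<union> B)" using y by simp
      thus False using card_Un_Int[OF a(2) b(2)] ct a(3) b(3) by linarith
    qed
    then obtain x where x: "x \<in> {1..?l}" "x \<notin> A" "x \<notin> B" by blast
    have "1 \<le> y" using y a by auto
    hence "x < y" using x y by auto
    hence A': "insert x (A - {y}) \<in> \<A>" using compressedD[OF compr less.prems(1), of x y] x y by auto
    have "insert x (A - {y}) \<inter> B - {1..?l} = (A \<inter> B - {1..?l}) - {y}" using x by auto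
    moreover have "card ((A \<inter> B - {1..?l}) - {y}) < card (A \<inter> B - {1..?l})"
      using y a by (intro card_Diff1_less) auto
    ultimately have "t \<le> card (insert x (A - {y}) \<inter> B \<inter> {1..?l})" using less.hyps[OF _ A'] less.prems by simp
    moreover have "insert x (A - {y}) \<inter> B \<inter> {1..?l} = A \<inter> B \<inter> {1..?l}" using x y by auto
    ultimately show ?thesis by simp
  qed
qed

lemma compressed_trace:
  assumes "compressed \<A>"
  shows "compressed ((\<lambda>A. A \<inter> {1..l}) ` \<A>)"
  unfolding compressed_def
proof (intro ballI allI impI)
  fix X x y assume X: "X \<in> (\<lambda>A. A \<inter> {1..l}) ` \<A>" and h: "0 < x" "x < y" "y \<in> X" "x \<notin> X"
  then obtain A where A: "A \<in> \<A>" "X = A \<inter> {1..l}" by auto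
  have xy: "x \<notin> A" "y \<in> A" "x \<in> {1..l}" using A h by auto
  from compressedD[OF assms A(1) h(1,2) xy(2,1)] have "insert x (A - {y}) \<in> \<A>" .
  moreover have "insert x (X - {y}) = insert x (A - {y}) \<inter> {1..l}" using A xy by auto
  ultimately show "insert x (X - {y}) \<in> (\<lambda>A. A \<inter> {1..l}) ` \<A>" by auto
qed

definition uniform_optimal ::
    "nat \<Rightarrow> nat \<Rightarrow> nat \<Rightarrow> nat \<Rightarrow> nat \<Rightarrow> nat set set \<Rightarrow> nat set set \<Rightarrow> bool" where
  "uniform_optimal m n r s t \<A> \<B> \<longleftrightarrow>
    \<A> \<subseteq> nsets {1..m} r \<and> \<B> \<subseteq> nsets {1..n} s \<and> cross t \<A> \<B> \<and>
    (\<forall>\<C> \<D>. \<C> \<subseteq> nsets {1..m} r \<longrightarrow> \<D> \<subseteq> nsets {1..n} s \<longrightarrow> cross t \<C> \<D> \<longrightarrow>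
      card \<C> * card \<D> \<le> card \<A> * card \<B>)"

lemma ext_count_trace_pos:
  assumes "X \<in> nsets {1..m} r"
  shows "0 < ext_count m r l (card (X \<inter> {1..l}))"
proof -
  have X: "X \<subseteq> {1..m}" "finite X" "card X = r" using assms by (auto simp: nsets_iff)
  have "card (X \<inter> {1..l}) \<le> r" using X card_mono[of X "X \<inter> {1..l}"] by auto
  have "X - {1..l} \<subseteq> {Suc l..m}" using X by force
  hence "card (X - {1..l}) \<le> m - l" using card_mono[of "{Suc l..m}" "X - {1..l}"] by simp
  moreover have "card (X - {1..l}) = r - card (X \<inter> {1..l})"
    using X by (simp add: card_Diff_subset_Int)
  ultimately show ?thesis using \<open>card (X \<inter> {1..l}) \<le> r\<close> by (simp add: ext_count_def)
qed

lemma cross_having_trace: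
  assumes "cross t \<C> \<D>"
  shows "cross t (having_trace m r l \<C>) (having_trace n s l \<D>)"
  unfolding cross_def
proof (intro ballI)
  fix X Y assume "X \<in> having_trace m r l \<C>" "Y \<in> having_trace n s l \<D>"
  hence h: "finite X" "X \<inter> {1..l} \<in> \<C>" "Y \<inter> {1..l} \<in> \<D>" by (auto simp: having_trace_def nsets_iff)
  have "t \<le> card ((X \<inter> {1..l}) \<inter> (Y \<inter> {1..l}))" using crossD[OF assms h(2,3)] .
  also have "\<dots> \<le> card (X \<inter> Y)" using h by (intro card_mono) auto
  finally show "t \<le> card (X \<inter> Y)" .
qed

lemma having_trace_fixing: "t \<le> l \<Longrightarrow> having_trace m r l (fixing t l) = star m r {1..t}"
  by (auto simp: having_trace_def fixing_def star_def)

text \<open>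
  The traces on \<open>{1..r + s - t}\<close> form an optimal pair in the weighted sense: a competing pair of families of
  traces is turned into a competing pair of uniform families by taking all sets with these traces, and the
  weight of a family of traces is the number of such sets.
\<close>
lemma compressed_optimal_bound:
  assumes opt: "uniform_optimal m n r s t \<A> \<B>"
    and compr: "compressed \<A>" "compressed \<B>" and ne: "\<A> \<noteq> {}" "\<B> \<noteq> {}"
    and t: "0 < t" "t \<le> r" "r \<le> s" "t < s" and lam: "real t \<le> lam" "(real t + 4) / 2 < lam"
    and m: "(lam + 2) * (real s - t) + r - 1 \<le> m" and n: "(lam + 2) * (real s - t) + r - 1 \<le> n"
  shows "card \<A> * card \<B> \<le> ((m - t) choose (r - t)) * ((n - t) choose (s - t)) \<and>
    (t < lam \<longrightarrow> (\<forall>A\<in>\<A> \<union> \<B>. {1..t} \<subseteq> A))"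
proof -
  define l where "l = r + s - t"
  define d where "d = s - t"
  have d: "real s - t = d" "1 \<le> d" "real l = real r + d" using t by (auto simp: d_def l_def of_nat_diff)
  have room: "l \<le> M \<and> (lam + 1) * d \<le> real (M - l) + 1" if "(lam + 2) * (real s - t) + r - 1 \<le> real M" for M
  proof -
    have 1: "(lam + 2) * d + r - 1 \<le> M" using that d by simp
    have "1 * 1 \<le> (lam + 1) * d" using d lam by (intro mult_mono) auto
    hence "real l \<le> M" using 1 d(3) by (simp add: algebra_simps)
    hence "l \<le> M" by simp
    thus ?thesis using 1 d(3) by (simp add: of_nat_diff algebra_simps)
  qed
  note rm = room[OF m] and rn = room[OF n]
  have tl: "t \<le> l" using t by (simp add: l_def)
  have A: "\<A> \<subseteq> nsets {1..m} r" and B: "\<B> \<subseteq> nsets {1..n} s" and c: "cross t \<A> \<B>"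
    and o: "\<And>\<C> \<D>. \<C> \<subseteq> nsets {1..m} r \<Longrightarrow> \<D> \<subseteq> nsets {1..n} s \<Longrightarrow> cross t \<C> \<D> \<Longrightarrow>
      card \<C> * card \<D> \<le> card \<A> * card \<B>"
    using opt unfolding uniform_optimal_def by auto
  let ?A = "(\<lambda>A. A \<inter> {1..l}) ` \<A>" and ?B = "(\<lambda>A. A \<inter> {1..l}) ` \<B>"
  let ?w = "ext_count m r l" and ?v = "ext_count n s l"
  have sub: "?A \<subseteq> Pow {1..l}" "?B \<subseteq> Pow {1..l}" by auto
  have "card \<A> \<le> card (having_trace m r l ?A)"
    using A by (intro card_mono) (auto simp: having_trace_def intro: finite_subset[OF _ finite_nsets_interval])
  hence wA: "real (card \<A>) \<le> weight ?w ?A" using card_having_trace[OF sub(1)] rm by (metis of_nat_le_iff)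
  have "card \<B> \<le> card (having_trace n s l ?B)"
    using B by (intro card_mono) (auto simp: having_trace_def intro: finite_subset[OF _ finite_nsets_interval])
  hence wB: "real (card \<B>) \<le> weight ?v ?B" using card_having_trace[OF sub(2)] rn by (metis of_nat_le_iff)
  have le: "real (card \<A>) * card \<B> \<le> weight ?w ?A * weight ?v ?B"
    using wA wB by (intro mult_mono) auto
  have "optimal_pair t l lam ?w ?v ?A ?B"
  proof
    show "0 \<le> ?w a" "0 \<le> ?v a" for a by (auto simp: ext_count_def)
    show "lam * ?w (Suc a) \<le> ?w a" if "t \<le> a" for a
      by (rule ext_count_ratio[OF that _ _ conjunct2[OF rm]]) (use t lam in \<open>auto simp: d_def\<close>)
    show "lam * ?v (Suc a) \<le> ?v a" if "t \<le> a" for a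
      by (rule ext_count_ratio[OF that _ _ conjunct2[OF rn]]) (use t lam in \<open>auto simp: d_def\<close>)
    show "compressed ?A" "compressed ?B" using compr compressed_trace by auto
    show "cross t ?A ?B"
      unfolding cross_def
    proof (clarify)
      fix X Y assume "X \<in> \<A>" "Y \<in> \<B>"
      from trace_cross[OF A B c compr(1) this]
      have "t \<le> card (X \<inter> Y \<inter> {1..l})" unfolding l_def .
      moreover have "X \<inter> {1..l} \<inter> (Y \<inter> {1..l}) = X \<inter> Y \<inter> {1..l}" by auto
      ultimately show "t \<le> card (X \<inter> {1..l} \<inter> (Y \<inter> {1..l}))" by simp
    qed
    show "0 < ?w (card X)" if "X \<in> ?A" for X using that A ext_count_trace_pos by auto
    show "0 < ?v (card X)" if "X \<in> ?B" for X using that B ext_count_trace_pos by auto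
    fix \<C> \<D> assume C: "\<C> \<subseteq> Pow {1..l}" and D: "\<D> \<subseteq> Pow {1..l}" and cc: "cross t \<C> \<D>"
    have "card (having_trace m r l \<C>) * card (having_trace n s l \<D>) \<le> card \<A> * card \<B>"
      by (rule o[OF _ _ cross_having_trace[OF cc]]) (auto simp: having_trace_def)
    hence "real (card (having_trace m r l \<C>)) * real (card (having_trace n s l \<D>)) \<le> real (card \<A>) * card \<B>"
      by (metis of_nat_le_iff of_nat_mult)
    thus "weight ?w \<C> * weight ?v \<D> \<le> weight ?w ?A * weight ?v ?B"
      using le card_having_trace[OF C conjunct1[OF rm]] card_having_trace[OF D conjunct1[OF rn]] by simp
  qed (use t tl lam ne in auto)
  from optimal_pair_fixing[OF this]
  have 1: "weight ?w ?A * weight ?v ?B \<le> weight ?w (fixing t l) * weight ?v (fixing t l)"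
    and 2: "t < lam \<longrightarrow> (\<forall>A\<in>?A \<union> ?B. {1..t} \<subseteq> A)" by auto
  have F: "fixing t l \<subseteq> Pow {1..l}" by (auto simp: fixing_def)
  have "t \<le> m" "t \<le> n" using tl rm rn by auto
  hence "weight ?w (fixing t l) = (m - t) choose (r - t)" "weight ?v (fixing t l) = (n - t) choose (s - t)"
    using card_having_trace[OF F, of m r] card_having_trace[OF F, of n s] rm rn t card_star[of "{1..t}" m r] card_star[of "{1..t}" n s]
    by (auto simp: having_trace_fixing[OF tl])
  with 1 le have "real (card \<A>) * card \<B> \<le> real ((m - t) choose (r - t)) * real ((n - t) choose (s - t))" by simp
  hence "card \<A> * card \<B> \<le> ((m - t) choose (r - t)) * ((n - t) choose (s - t))"
    by (metis of_nat_le_iff of_nat_mult)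
  moreover have "{1..t} \<subseteq> A" if "t < lam" "A \<in> \<A> \<union> \<B>" for A
  proof -
    have "A \<inter> {1..l} \<in> ?A \<union> ?B" using that(2) by auto
    hence "{1..t} \<subseteq> A \<inter> {1..l}" using 2 that(1) by metis
    thus ?thesis by simp
  qed
  ultimately show ?thesis by blast
qed

section \<open>Shifting\<close>

definition replace_larger :: "nat \<Rightarrow> nat \<Rightarrow> nat set \<Rightarrow> nat set" where
  "replace_larger x y A = (if y \<in> A \<and> x \<notin> A then insert x (A - {y}) else A)"

text \<open>
  The effect of the shift on a member of the family: it stays where it is if its target is already taken.
  Defining \<open>shift\<close> as the image of an injection makes the invariance of sizes immediate.
\<close>
definition moved :: "nat \<Rightarrow> nat \<Rightarrow> nat set set \<Rightarrow> nat set \<Rightarrow> nat set" where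
  "moved x y \<A> A = (if replace_larger x y A \<in> \<A> then A else replace_larger x y A)"

definition shift :: "nat \<Rightarrow> nat \<Rightarrow> nat set set \<Rightarrow> nat set set" where
  "shift x y \<A> = moved x y \<A> ` \<A>"

lemma moved_cases:
  assumes "A \<in> \<A>"
  obtains (stay) "moved x y \<A> A = A" "replace_larger x y A \<in> \<A>"
    | (move) "moved x y \<A> A = insert x (A - {y})" "insert x (A - {y}) \<notin> \<A>" "y \<in> A" "x \<notin> A"
  using assms unfolding moved_def replace_larger_def by (cases "y \<in> A \<and> x \<notin> A") (auto split: if_splits)

lemma moved_inj: "inj_on (moved x y \<A>) \<A>"
proof (rule inj_onI)
  fix A B assume A: "A \<in> \<A>" and B: "B \<in> \<A>" and e: "moved x y \<A> A = moved x y \<A> B"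
  from A show "A = B"
  proof (cases rule: moved_cases[where x = x and y = y])
    case stay
    from B show ?thesis
      by (cases rule: moved_cases[where x = x and y = y]) (use stay e A in auto)
  next
    case a: move
    from B show ?thesis
    proof (cases rule: moved_cases[where x = x and y = y])
      case stay thus ?thesis using a e B by auto
    next
      case b: move
      have "insert x (A - {y}) = insert x (B - {y})" using a b e by simp
      hence "A - {y} = B - {y}" using a b by (metis Diff_iff insert_ident)
      thus ?thesis using a b by (metis insert_Diff)
    qed
  qed
qed

lemma card_shift: "card (shift x y \<A>) = card \<A>"
  unfolding shift_def by (rule card_image[OF moved_inj])

lemma shift_uniform:
  assumes "\<A> \<subseteq> nsets {1..m} r" "0 < x" "x < y"
  shows "shift x y \<A> \<subseteq> nsets {1..m} r"
proof
  fix X assume "X \<in> shift x y \<A>"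
  then obtain A where A: "A \<in> \<A>" "X = moved x y \<A> A" unfolding shift_def by auto
  have n: "A \<subseteq> {1..m}" "finite A" "card A = r" using subsetD[OF assms(1) A(1)] by (auto simp: nsets_iff)
  from A(1) show "X \<in> nsets {1..m} r"
  proof (cases rule: moved_cases[where x = x and y = y])
    case stay thus ?thesis using A n by (simp add: nsets_iff)
  next
    case move
    have "x \<le> m" using n move assms by auto
    hence "insert x (A - {y}) \<subseteq> {1..m}" using n assms by auto
    moreover have "card (insert x (A - {y})) = r"
      using n move card_gt_0_iff[of A] by (auto simp: card_Diff_singleton)
    ultimately show ?thesis using A move n by (simp add: nsets_iff)
  qed
qed

text \<open>
  The only delicate case is \<open>x \<notin> B\<close>, \<open>y \<in> B\<close>: then \<open>B\<close> stayed because its target is in the family, and the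
  original \<open>A\<close> meets that target in the same set in which the shifted \<open>A\<close> meets \<open>B\<close>.
\<close>
lemma cross_move_stay:
  assumes c: "cross t \<A> \<B>" and A: "A \<in> \<A>" "y \<in> A" "x \<notin> A" "finite A"
    and B: "B \<in> \<B>" "replace_larger x y B \<in> \<B>"
  shows "t \<le> card (insert x (A - {y}) \<inter> B)"
proof (cases "x \<in> B")
  case True
  have "card (A \<inter> B) \<le> card (insert x (A - {y}) \<inter> B)"
  proof (cases "y \<in> B")
    case y: True
    have "insert x (A - {y}) \<inter> B = insert x (A \<inter> B - {y})" using True by auto
    moreover have "card (insert x (A \<inter> B - {y})) = card (A \<inter> B)"
      using A y card_gt_0_iff[of "A \<inter> B"] by (auto simp: card_Diff_singleton)
    ultimately show ?thesis by simp
  next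
    case False
    thus ?thesis using A(4) by (intro card_mono) auto
  qed
  thus ?thesis using crossD[OF c A(1) B(1)] by simp
next
  case False
  have "insert x (A - {y}) \<inter> B = A \<inter> replace_larger x y B" using False A unfolding replace_larger_def by auto
  thus ?thesis using crossD[OF c A(1) B(2)] by simp
qed

lemma cross_shift:
  assumes c: "cross t \<A> \<B>" and fin: "\<And>A. A \<in> \<A> \<Longrightarrow> finite A" "\<And>B. B \<in> \<B> \<Longrightarrow> finite B"
  shows "cross t (shift x y \<A>) (shift x y \<B>)"
  unfolding cross_def
proof (intro ballI)
  fix X Y assume "X \<in> shift x y \<A>" "Y \<in> shift x y \<B>"
  then obtain A B where A: "A \<in> \<A>" "X = moved x y \<A> A" and B: "B \<in> \<B>" "Y = moved x y \<B> B"
    unfolding shift_def by auto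
  from A(1) show "t \<le> card (X \<inter> Y)"
  proof (cases rule: moved_cases[where x = x and y = y])
    case a: stay
    from B(1) show ?thesis
    proof (cases rule: moved_cases[where x = x and y = y])
      case stay thus ?thesis using a A B crossD[OF c] by simp
    next
      case move
      from cross_move_stay[OF cross_sym[OF c] B(1) move(3,4) fin(2)[OF B(1)] A(1) a(2)]
      show ?thesis using a move A B by (simp add: Int_commute)
    qed
  next
    case a: move
    from B(1) show ?thesis
    proof (cases rule: moved_cases[where x = x and y = y])
      case stay
      from cross_move_stay[OF c A(1) a(3,4) fin(1)[OF A(1)] B(1) stay(2)]
      show ?thesis using a stay A B by simp
    next
      case b: move
      have "X \<inter> Y = insert x (A \<inter> B - {y})" using a b A B by auto
      moreover have "card (insert x (A \<inter> B - {y})) = card (A \<inter> B)"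
        using a b fin(1)[OF A(1)] card_gt_0_iff[of "A \<inter> B"] by (auto simp: card_Diff_singleton)
      ultimately show ?thesis using crossD[OF c A(1) B(1)] by simp
    qed
  qed
qed

lemma uniform_optimal_shift:
  assumes "uniform_optimal m n r s t \<A> \<B>" "0 < x" "x < y"
  shows "uniform_optimal m n r s t (shift x y \<A>) (shift x y \<B>)"
proof -
  have A: "\<A> \<subseteq> nsets {1..m} r" and B: "\<B> \<subseteq> nsets {1..n} s" and c: "cross t \<A> \<B>"
    using assms unfolding uniform_optimal_def by auto
  have "cross t (shift x y \<A>) (shift x y \<B>)"
    by (rule cross_shift[OF c]) (use A B in \<open>auto simp: nsets_iff\<close>)
  thus ?thesis
    using assms shift_uniform[OF A assms(2,3)] shift_uniform[OF B assms(2,3)]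
    unfolding uniform_optimal_def card_shift by blast
qed

text \<open>
  A potential that decreases with every shift that has an effect.
\<close>
definition element_sum :: "nat set set \<Rightarrow> nat" where
  "element_sum \<A> = (\<Sum>A\<in>\<A>. \<Sum>A)"

lemma element_sum_shift_le:
  assumes A: "finite \<A>" "\<And>A. A \<in> \<A> \<Longrightarrow> finite A" and xy: "x < y"
  shows "element_sum (shift x y \<A>) \<le> element_sum \<A>"
    and "A0 \<in> \<A> \<Longrightarrow> y \<in> A0 \<Longrightarrow> x \<notin> A0 \<Longrightarrow> insert x (A0 - {y}) \<notin> \<A> \<Longrightarrow> element_sum (shift x y \<A>) < element_sum \<A>"
proof -
  have e: "element_sum (shift x y \<A>) = (\<Sum>A\<in>\<A>. \<Sum>(moved x y \<A> A))"
    unfolding element_sum_def shift_def by (simp add: sum.reindex[OF moved_inj])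
  have mv: "\<Sum>(insert x (A - {y})) < \<Sum>A" if "A \<in> \<A>" "y \<in> A" "x \<notin> A" for A
  proof -
    have "\<Sum>A = y + \<Sum>(A - {y})" using that A(2) by (simp add: sum.remove)
    moreover have "\<Sum>(insert x (A - {y})) = x + \<Sum>(A - {y})" using that A(2) by simp
    ultimately show ?thesis using xy by simp
  qed
  have le: "\<Sum>(moved x y \<A> A) \<le> \<Sum>A" if "A \<in> \<A>" for A
    using that
  proof (cases rule: moved_cases[where x = x and y = y])
    case stay thus ?thesis by simp
  next
    case move thus ?thesis using mv[OF that] by simp
  qed
  show "element_sum (shift x y \<A>) \<le> element_sum \<A>" unfolding e unfolding element_sum_def by (rule sum_mono[OF le])
  assume h: "A0 \<in> \<A>" "y \<in> A0" "x \<notin> A0" "insert x (A0 - {y}) \<notin> \<A>"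
  have "moved x y \<A> A0 = insert x (A0 - {y})" using h by (simp add: moved_def replace_larger_def)
  hence "\<Sum>(moved x y \<A> A0) < \<Sum>A0" using mv[OF h(1-3)] by simp
  thus "element_sum (shift x y \<A>) < element_sum \<A>" unfolding e unfolding element_sum_def
    using h(1) le by (intro sum_strict_mono_ex1[OF A(1)]) auto
qed

section \<open>Undoing a shift that produces stars\<close>

text \<open>
  The two stars form a competing pair, so an optimal pair inside them cannot be smaller in either component;
  that the stars are nonempty is what allows one to compare the components separately.
\<close>
lemma optimal_full_star:
  assumes opt: "uniform_optimal m n r s t \<A> \<B>" and T: "card T = t" "T \<subseteq> {1..m}" "T \<subseteq> {1..n}" "t \<le> r" "t \<le> s"
    and pos: "0 < (m - t) choose (r - t)" "0 < (n - t) choose (s - t)"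
    and sub: "\<And>A. A \<in> \<A> \<union> \<B> \<Longrightarrow> T \<subseteq> A"
  shows "\<A> = star m r T \<and> \<B> = star n s T"
proof -
  have A: "\<A> \<subseteq> nsets {1..m} r" and B: "\<B> \<subseteq> nsets {1..n} s"
    using opt unfolding uniform_optimal_def by auto
  have fin: "finite (star m r T)" "finite (star n s T)"
    using finite_nsets_interval by (auto simp: star_def)
  have sA: "\<A> \<subseteq> star m r T" and sB: "\<B> \<subseteq> star n s T" using A B sub by (auto simp: star_def)
  have cs: "card (star m r T) = (m - t) choose (r - t)" "card (star n s T) = (n - t) choose (s - t)"
    using card_star T by auto
  have "cross t (star m r T) (star n s T)" by (rule cross_star[OF T(1)])
  hence le: "card (star m r T) * card (star n s T) \<le> card \<A> * card \<B>"
    using opt unfolding uniform_optimal_def by (auto simp: star_def)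
  have cA: "card \<A> \<le> card (star m r T)" and cB: "card \<B> \<le> card (star n s T)"
    using sA sB fin card_mono by auto
  have "card (star m r T) \<le> card \<A>"
  proof (rule ccontr)
    assume "\<not> ?thesis"
    hence "card \<A> * card (star n s T) < card (star m r T) * card (star n s T)"
      using pos cs by simp
    moreover have "card \<A> * card \<B> \<le> card \<A> * card (star n s T)" using cB by simp
    ultimately have "card \<A> * card \<B> < card (star m r T) * card (star n s T)" by linarith
    thus False using le by simp
  qed
  moreover have "card (star n s T) \<le> card \<B>"
  proof (rule ccontr)
    assume "\<not> ?thesis"
    hence "card (star m r T) * card \<B> < card (star m r T) * card (star n s T)"
      using pos cs by simp
    moreover have "card \<A> * card \<B> \<le> card (star m r T) * card \<B>" using cA by simp
    ultimately have "card \<A> * card \<B> < card (star m r T) * card (star n s T)" by linarith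
    thus False using le by simp
  qed
  ultimately show ?thesis using sA sB fin card_seteq by blast
qed

lemma nsets_avoiding:
  assumes "finite Z" "finite R" "k + card R \<le> card Z"
  obtains S where "S \<in> nsets Z k" "S \<inter> R = {}"
proof -
  have "k \<le> card (Z - R)" using assms diff_card_le_card_Diff[of R Z] by linarith
  then obtain S where "S \<subseteq> Z - R" "card S = k" "finite S" by (rule obtain_subset_with_card_n)
  thus thesis using that[of S] by (auto simp: nsets_iff)
qed

lemma shift_star_preimage:
  assumes sh: "shift x y \<A> = star m r T" and T: "x \<in> T" "y \<notin> T"
  shows "\<And>A. A \<in> \<A> \<Longrightarrow> T \<subseteq> A \<or> insert y (T - {x}) \<subseteq> A \<and> x \<notin> A"
    and "\<And>A. A \<in> star m r T \<Longrightarrow> y \<notin> A \<Longrightarrow> A \<in> \<A> \<or> insert y (A - {x}) \<in> \<A>"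
proof -
  fix A assume A: "A \<in> \<A>"
  hence in_star: "moved x y \<A> A \<in> star m r T" using sh unfolding shift_def by auto
  hence TA: "T \<subseteq> moved x y \<A> A" by (simp add: star_def)
  from A show "T \<subseteq> A \<or> insert y (T - {x}) \<subseteq> A \<and> x \<notin> A"
  proof (cases rule: moved_cases[where x = x and y = y])
    case stay thus ?thesis using TA by simp
  next
    case move thus ?thesis using TA by auto
  qed
next
  fix A assume A: "A \<in> star m r T" "y \<notin> A"
  then obtain A0 where A0: "A0 \<in> \<A>" "A = moved x y \<A> A0" using sh unfolding shift_def by auto
  from A0(1) show "A \<in> \<A> \<or> insert y (A - {x}) \<in> \<A>"
  proof (cases rule: moved_cases[where x = x and y = y])
    case stay thus ?thesis using A0 by simp
  next
    case move
    hence "insert y (A - {x}) = A0" using A0 by auto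
    thus ?thesis using A0 by simp
  qed
qed

text \<open>
  Here \<open>T'\<close> is the set that the shift turns into \<open>T\<close>. Every \<open>S\<close> of the right size outside \<open>T\<close> and \<open>T'\<close> extends
  one of the two to a member of the original family, and a member that does not contain \<open>T\<close> (or \<open>T'\<close>) arises
  in this way from the other one.
\<close>
lemma shift_star_types:
  assumes sh: "shift x y \<A> = star m r T" and \<A>: "\<A> \<subseteq> nsets {1..m} r"
    and T: "x \<in> T" "y \<notin> T" "card T = t" "T \<subseteq> {1..m}" "t \<le> r"
  defines "T' \<equiv> insert y (T - {x})" and "P \<equiv> nsets ({1..m} - insert y T) (r - t)"
  shows "\<And>S. S \<in> P \<Longrightarrow> S \<union> T \<in> \<A> \<or> S \<union> T' \<in> \<A>"
    and "\<And>A. A \<in> \<A> \<Longrightarrow> \<not> T \<subseteq> A \<Longrightarrow> A - T' \<in> P \<and> (A - T') \<union> T' \<in> \<A>"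
    and "\<And>A. A \<in> \<A> \<Longrightarrow> \<not> T' \<subseteq> A \<Longrightarrow> A - T \<in> P \<and> (A - T) \<union> T \<in> \<A>"
proof -
  note pre = shift_star_preimage[OF sh T(1,2)]
  have fT: "finite T" using T(4) finite_subset by blast
  have "0 < card T" using T fT card_gt_0_iff by blast
  hence cT': "card T' = t" "finite T'" using fT T by (simp_all add: T'_def card_Diff_singleton)
  {
    fix S assume "S \<in> P"
    hence S: "S \<subseteq> {1..m} - insert y T" "finite S" "card S = r - t" by (simp_all add: P_def nsets_iff)
    have "S \<inter> T = {}" using S by auto
    hence "card (S \<union> T) = r" using S fT T by (simp add: card_Un_disjoint)
    hence "S \<union> T \<in> star m r T" using S fT T(4) by (auto simp: star_def nsets_iff)
    moreover have "y \<notin> S \<union> T" using S T by auto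
    ultimately have "S \<union> T \<in> \<A> \<or> insert y ((S \<union> T) - {x}) \<in> \<A>" by (rule pre(2))
    moreover have "insert y ((S \<union> T) - {x}) = S \<union> T'" using S T by (auto simp: T'_def)
    ultimately show "S \<union> T \<in> \<A> \<or> S \<union> T' \<in> \<A>" by simp
  }
  {
    fix A assume A: "A \<in> \<A>" "\<not> T \<subseteq> A"
    have n: "A \<subseteq> {1..m}" "finite A" "card A = r" using subsetD[OF \<A> A(1)] by (simp_all add: nsets_iff)
    have h: "T' \<subseteq> A" "x \<notin> A" using pre(1)[OF A(1)] A(2) by (auto simp: T'_def)
    have "A - T' \<subseteq> {1..m} - insert y T" using n h by (auto simp: T'_def)
    moreover have "card (A - T') = r - t" using h n cT' by (simp add: card_Diff_subset)
    moreover have "(A - T') \<union> T' = A" using h by auto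
    ultimately show "A - T' \<in> P \<and> (A - T') \<union> T' \<in> \<A>" using A n by (simp add: P_def nsets_iff)
  }
  {
    fix A assume A: "A \<in> \<A>" "\<not> T' \<subseteq> A"
    have n: "A \<subseteq> {1..m}" "finite A" "card A = r" using subsetD[OF \<A> A(1)] by (simp_all add: nsets_iff)
    have h: "T \<subseteq> A" using pre(1)[OF A(1)] A(2) by (auto simp: T'_def)
    have "y \<notin> A" using A(2) h by (auto simp: T'_def)
    hence "A - T \<subseteq> {1..m} - insert y T" using n h by auto
    moreover have "card (A - T) = r - t" using h n fT T by (simp add: card_Diff_subset)
    moreover have "(A - T) \<union> T = A" using h by auto
    ultimately show "A - T \<in> P \<and> (A - T) \<union> T \<in> \<A>" using A n by (simp add: P_def nsets_iff)
  }
qed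

text \<open>
  Call a set \<open>S\<close> as in the previous lemma a \<open>T\<close>-set or a \<open>T'\<close>-set according to which of \<open>S \<union> T\<close> and \<open>S \<union> T'\<close>
  belongs to the family. Disjoint sets from the two sides cannot be of different types, because \<open>T\<close> and \<open>T'\<close>
  share only \<open>t - 1\<close> elements. The second room assumption provides, for any two sets of the first side, a set
  of the second side disjoint from both, so all sets of the first side have the same type; the first room
  assumption transfers this to the second side.
\<close>
lemma unshift_exchanged:
  assumes A: "\<A> \<subseteq> nsets {1..m} r" and B: "\<B> \<subseteq> nsets {1..n} s" and c: "cross t \<A> \<B>"
    and shA: "shift x y \<A> = star m r T" and shB: "shift x y \<B> = star n s T"
    and T: "x \<in> T" "y \<notin> T" "card T = t" "T \<subseteq> {1..m}" "T \<subseteq> {1..n}" and tr: "t \<le> r" "t \<le> s"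
    and room: "r + s + 1 \<le> m + t" "2 * r + s + 1 \<le> n + 2 * t"
  shows "\<exists>T'. card T' = t \<and> (\<forall>A\<in>\<A> \<union> \<B>. T' \<subseteq> A)"
proof -
  define T' where "T' = insert y (T - {x})"
  define P where "P = nsets ({1..m} - insert y T) (r - t)"
  define Q where "Q = nsets ({1..n} - insert y T) (s - t)"
  note tA = shift_star_types[OF shA A T(1-4) tr(1), folded T'_def P_def]
  note tB = shift_star_types[OF shB B T(1-3,5) tr(2), folded T'_def Q_def]
  have fT: "finite T" using T(4) finite_subset by blast
  have t0: "0 < t" using T fT card_gt_0_iff by blast
  have cT': "card T' = t" using fT T t0 by (auto simp: T'_def card_Diff_singleton)
  have cU: "card (T - {x}) < t" using fT T t0 by (simp add: card_Diff_singleton)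
  have Z: "M \<le> card ({1..M} - insert y T) + (t + 1)" for M
    using diff_card_le_card_Diff[of "insert y T" "{1..M}"] fT T by simp
  have dP: "\<exists>S\<in>P. S \<inter> R = {}" if "R \<in> Q" for R
  proof -
    have R: "finite R" "card R = s - t" using that by (simp_all add: Q_def nsets_iff)
    have "r - t + card R \<le> card ({1..m} - insert y T)" using Z[of m] room tr R by linarith
    from nsets_avoiding[OF _ R(1) this] show ?thesis unfolding P_def by blast
  qed
  have dQ: "\<exists>R\<in>Q. R \<inter> (S \<union> S') = {}" if "S \<in> P" "S' \<in> P" for S S'
  proof -
    have S: "finite (S \<union> S')" "card S = r - t" "card S' = r - t" using that by (simp_all add: P_def nsets_iff)
    have "card (S \<union> S') \<le> 2 * (r - t)" using card_Un_le[of S S'] S by simp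
    hence "s - t + card (S \<union> S') \<le> card ({1..n} - insert y T)" using Z[of n] room tr by linarith
    from nsets_avoiding[OF _ S(1) this] show ?thesis unfolding Q_def by blast
  qed
  have clash: False if "S \<in> P" "R \<in> Q" "S \<inter> R = {}"
    and "S \<union> T \<in> \<A> \<and> R \<union> T' \<in> \<B> \<or> S \<union> T' \<in> \<A> \<and> R \<union> T \<in> \<B>" for S R
  proof -
    have "S \<inter> insert y T = {}" "R \<inter> insert y T = {}" using that(1,2) by (auto simp: P_def Q_def nsets_iff)
    hence "(S \<union> T) \<inter> (R \<union> T') = T - {x}" "(S \<union> T') \<inter> (R \<union> T) = T - {x}"
      using that(3) T by (auto simp: T'_def)
    thus False using that(4) crossD[OF c] cU by (metis not_less)
  qed
  show ?thesis
  proof (cases "\<exists>S\<in>P. S \<union> T \<in> \<A>")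
    case True
    then obtain S where S: "S \<in> P" "S \<union> T \<in> \<A>" by auto
    have noA: "S' \<union> T' \<notin> \<A>" if S': "S' \<in> P" for S'
    proof
      assume y: "S' \<union> T' \<in> \<A>"
      obtain R where R: "R \<in> Q" "R \<inter> (S \<union> S') = {}" using dQ[OF S(1) S'] by auto
      hence d: "S \<inter> R = {}" "S' \<inter> R = {}" by auto
      from tB(1)[OF R(1)] show False using clash[OF S(1) R(1) d(1)] clash[OF S' R(1) d(2)] S(2) y by auto
    qed
    have "T \<subseteq> A" if "A \<in> \<A>" for A using tA(2)[OF that] noA by blast
    moreover have "T \<subseteq> B" if "B \<in> \<B>" for B
    proof (rule ccontr)
      assume "\<not> T \<subseteq> B"
      from tB(2)[OF that this] have R: "B - T' \<in> Q" "(B - T') \<union> T' \<in> \<B>" by auto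
      obtain S' where S': "S' \<in> P" "S' \<inter> (B - T') = {}" using dP[OF R(1)] by auto
      have "S' \<union> T \<in> \<A>" using tA(1)[OF S'(1)] noA[OF S'(1)] by simp
      thus False using clash[OF S'(1) R(1) S'(2)] R(2) by simp
    qed
    ultimately show ?thesis using T(3) by blast
  next
    case False
    have "T' \<subseteq> A" if "A \<in> \<A>" for A using tA(3)[OF that] False by blast
    moreover have "T' \<subseteq> B" if "B \<in> \<B>" for B
    proof (rule ccontr)
      assume "\<not> T' \<subseteq> B"
      from tB(3)[OF that this] have R: "B - T \<in> Q" "(B - T) \<union> T \<in> \<B>" by auto
      obtain S' where S': "S' \<in> P" "S' \<inter> (B - T) = {}" using dP[OF R(1)] by auto
      have "S' \<union> T' \<in> \<A>" using tA(1)[OF S'(1)] False S'(1) by auto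
      thus False using clash[OF S'(1) R(1) S'(2)] R(2) by simp
    qed
    ultimately show ?thesis using cT' by blast
  qed
qed

text \<open>
  Unless \<open>x \<in> T\<close> and \<open>y \<notin> T\<close>, a set that contains \<open>T\<close> after being shifted contained it before.
\<close>
lemma unshift_star:
  assumes A: "\<A> \<subseteq> nsets {1..m} r" and B: "\<B> \<subseteq> nsets {1..n} s" and c: "cross t \<A> \<B>"
    and xy: "x < y"
    and shA: "shift x y \<A> = star m r T" and shB: "shift x y \<B> = star n s T"
    and T: "card T = t" "T \<subseteq> {1..m}" "T \<subseteq> {1..n}" and tr: "t \<le> r" "t \<le> s"
    and room: "r + s + 1 \<le> m + t" "2 * r + s + 1 \<le> n + 2 * t"
  shows "\<exists>T'. card T' = t \<and> (\<forall>A\<in>\<A> \<union> \<B>. T' \<subseteq> A)"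
proof (cases "x \<in> T \<and> y \<notin> T")
  case True
  thus ?thesis using unshift_exchanged[OF A B c shA shB _ _ T tr room] by blast
next
  case False
  have "T \<subseteq> F" if "shift x y \<F> = star M q T" "F \<in> \<F>" for \<F> M q F
  proof -
    have "T \<subseteq> moved x y \<F> F" using that unfolding shift_def star_def by blast
    with that(2) show ?thesis
      by (cases rule: moved_cases[where x = x and y = y]) (use False xy in auto)
  qed
  thus ?thesis using shA shB T(1) by blast
qed

section \<open>The bound for two families\<close>

lemma ground_set_bound:
  fixes lam :: real and m r s t :: nat
  assumes "(lam + 2) * (real s - t) + r - 1 \<le> real m" "2 < lam" "t < s"
  shows "4 * (s - t) + r \<le> m"
proof -
  obtain d where d: "s = t + d" "0 < d" using less_imp_add_positive[OF assms(3)] by blast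
  have e: "real s - real t = real d" by (simp add: d(1))
  have "4 * real d < (lam + 2) * real d" using assms(2) d(2) by simp
  hence "4 * real d + real r < real m + 1" using assms(1) unfolding e by linarith
  hence "real (4 * d + r) < real (m + 1)" by simp
  hence "4 * d + r < m + 1" by (simp only: of_nat_less_iff)
  thus ?thesis by (simp add: d(1))
qed

text \<open>
  Shift until both families are compressed. The bound is insensitive to shifting; the common \<open>t\<close>-set is
  recovered by undoing the shifts, which requires that the shifted families are full stars, and they are,
  because the pair is optimal.
\<close>
lemma uniform_optimal_bound:
  assumes t: "0 < t" "t \<le> r" "r \<le> s" "t < s" and lam: "real t \<le> lam" "(real t + 4) / 2 < lam"
    and m: "(lam + 2) * (real s - t) + r - 1 \<le> m" and n: "(lam + 2) * (real s - t) + r - 1 \<le> n"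
  shows "uniform_optimal m n r s t \<A> \<B> \<Longrightarrow>
    card \<A> * card \<B> \<le> ((m - t) choose (r - t)) * ((n - t) choose (s - t)) \<and>
    (t < lam \<longrightarrow> (\<exists>T. card T = t \<and> (\<forall>A\<in>\<A> \<union> \<B>. T \<subseteq> A)))"
proof (induction "element_sum \<A> + element_sum \<B>" arbitrary: \<A> \<B> rule: less_induct)
  case less
  have lam2: "2 < lam" using lam by simp
  note nm = ground_set_bound[OF m lam2 t(4)] and nn = ground_set_bound[OF n lam2 t(4)]
  have A: "\<A> \<subseteq> nsets {1..m} r" and B: "\<B> \<subseteq> nsets {1..n} s" and c: "cross t \<A> \<B>"
    using less.prems unfolding uniform_optimal_def by auto
  have fin: "finite \<A>" "finite \<B>" using A B finite_nsets_interval finite_subset by blast+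
  have finm: "\<And>X. X \<in> \<A> \<Longrightarrow> finite X" "\<And>X. X \<in> \<B> \<Longrightarrow> finite X" using A B by (auto simp: nsets_iff)
  have pos: "0 < (m - t) choose (r - t)" "0 < (n - t) choose (s - t)"
    using nm nn t by (auto intro!: zero_less_binomial)
  have ne: "\<A> \<noteq> {}" "\<B> \<noteq> {}"
  proof -
    have s: "star m r {1..t} \<subseteq> nsets {1..m} r" "star n s {1..t} \<subseteq> nsets {1..n} s" by (auto simp: star_def)
    have "cross t (star m r {1..t}) (star n s {1..t})" by (rule cross_star) simp
    with less.prems s have le: "card (star m r {1..t}) * card (star n s {1..t}) \<le> card \<A> * card \<B>"
      unfolding uniform_optimal_def by blast
    have "card (star m r {1..t}) = (m - t) choose (r - t)" "card (star n s {1..t}) = (n - t) choose (s - t)"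
      using card_star[of "{1..t}" m r] card_star[of "{1..t}" n s] nm nn t by auto
    hence "0 < card (star m r {1..t}) * card (star n s {1..t})" using pos by simp
    hence "0 < card \<A> * card \<B>" using le by (rule less_le_trans)
    thus "\<A> \<noteq> {}" "\<B> \<noteq> {}" by auto
  qed
  show ?case
  proof (cases "compressed \<A> \<and> compressed \<B>")
    case True
    note cb = compressed_optimal_bound[OF less.prems conjunct1[OF True] conjunct2[OF True] ne t lam m n]
    show ?thesis
    proof (intro conjI impI exI[of _ "{1..t}"])
      assume "t < lam"
      with cb show "\<forall>A\<in>\<A> \<union> \<B>. {1..t} \<subseteq> A" by (rule mp[OF conjunct2])
    qed (use cb in simp_all)
  next
    case False
    obtain x y where xy: "0 < x" "x < y" and
      dec: "element_sum (shift x y \<A>) + element_sum (shift x y \<B>) < element_sum \<A> + element_sum \<B>"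
    proof -
      from False consider "\<not> compressed \<A>" | "\<not> compressed \<B>" by auto
      thus thesis
      proof cases
        case 1
        then obtain A0 x y where h: "A0 \<in> \<A>" "0 < x" "x < y" "y \<in> A0" "x \<notin> A0" "insert x (A0 - {y}) \<notin> \<A>"
          unfolding compressed_def by blast
        have "element_sum (shift x y \<A>) < element_sum \<A>"
          by (rule element_sum_shift_le(2)[OF fin(1) finm(1) h(3,1,4,5,6)])
        moreover have "element_sum (shift x y \<B>) \<le> element_sum \<B>"
          by (rule element_sum_shift_le(1)[OF fin(2) finm(2) h(3)])
        ultimately show thesis by (intro that[OF h(2,3)] add_less_le_mono)
      next
        case 2
        then obtain A0 x y where h: "A0 \<in> \<B>" "0 < x" "x < y" "y \<in> A0" "x \<notin> A0" "insert x (A0 - {y}) \<notin> \<B>"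
          unfolding compressed_def by blast
        have "element_sum (shift x y \<B>) < element_sum \<B>"
          by (rule element_sum_shift_le(2)[OF fin(2) finm(2) h(3,1,4,5,6)])
        moreover have "element_sum (shift x y \<A>) \<le> element_sum \<A>"
          by (rule element_sum_shift_le(1)[OF fin(1) finm(1) h(3)])
        ultimately show thesis by (intro that[OF h(2,3)] add_le_less_mono)
      qed
    qed
    have opt': "uniform_optimal m n r s t (shift x y \<A>) (shift x y \<B>)"
      by (rule uniform_optimal_shift[OF less.prems xy])
    note IH = less.hyps[OF dec opt', unfolded card_shift]
    have "\<exists>T. card T = t \<and> (\<forall>A\<in>\<A> \<union> \<B>. T \<subseteq> A)" if tl: "t < lam"
    proof -
      from mp[OF conjunct2[OF IH] tl]
      obtain T where T0: "card T = t \<and> (\<forall>X\<in>shift x y \<A> \<union> shift x y \<B>. T \<subseteq> X)" by (elim exE)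
      note T = conjunct1[OF T0] bspec[OF conjunct2[OF T0]]
      have "shift x y \<A> \<noteq> {}" "shift x y \<B> \<noteq> {}" using ne by (simp_all add: shift_def)
      then obtain X Y where XY: "X \<in> shift x y \<A>" "Y \<in> shift x y \<B>" by blast
      have "X \<subseteq> {1..m}" "Y \<subseteq> {1..n}"
        using subsetD[OF shift_uniform[OF A xy] XY(1)] subsetD[OF shift_uniform[OF B xy] XY(2)]
        by (simp_all add: nsets_iff)
      moreover have "T \<subseteq> X" "T \<subseteq> Y" using T(2)[of X] T(2)[of Y] XY by simp_all
      ultimately have Ts: "T \<subseteq> {1..m}" "T \<subseteq> {1..n}" by simp_all
      have ts: "t \<le> s" using t by simp
      have full: "shift x y \<A> = star m r T \<and> shift x y \<B> = star n s T"
        by (rule optimal_full_star[OF opt' T(1) Ts t(2) ts pos T(2)])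
      note st = conjunct1[OF full] conjunct2[OF full]
      have "r + s + 1 \<le> m + t" "2 * r + s + 1 \<le> n + 2 * t" using nm nn t by linarith+
      from unshift_star[OF A B c xy(2) st T(1) Ts t(2) ts this] show ?thesis .
    qed
    thus ?thesis using conjunct1[OF IH] by (intro conjI impI)
  qed
qed

lemma uniform_optimal_exists:
  obtains \<C> \<D> where "uniform_optimal m n r s t \<C> \<D>"
proof -
  define P where "P = (\<lambda>(\<C>, \<D>). \<C> \<subseteq> nsets {1..m} r \<and> \<D> \<subseteq> nsets {1..n} s \<and> cross t \<C> \<D>)"
  define f :: "nat set set \<times> nat set set \<Rightarrow> nat" where "f = (\<lambda>(\<C>, \<D>). card \<C> * card \<D>)"
  have P0: "P ({}, {})" by (simp add: P_def cross_def)
  have "\<forall>p. P p \<longrightarrow> f p < Suc (card (nsets {1..m} r) * card (nsets {1..n} s))"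
  proof (intro allI impI)
    fix p assume p: "P p"
    obtain \<C> \<D> where e: "p = (\<C>, \<D>)" by (cases p)
    have "card \<C> \<le> card (nsets {1..m} r)" "card \<D> \<le> card (nsets {1..n} s)"
      by (rule card_mono[OF finite_nsets_interval], use p in \<open>simp add: e P_def\<close>)+
    hence "card \<C> * card \<D> \<le> card (nsets {1..m} r) * card (nsets {1..n} s)" by (rule mult_le_mono)
    thus "f p < Suc (card (nsets {1..m} r) * card (nsets {1..n} s))" by (simp add: e f_def)
  qed
  from ex_has_greatest_nat[of P, OF P0 this]
  obtain p where p: "P p" "\<And>q. P q \<Longrightarrow> f q \<le> f p" by blast
  obtain \<C> \<D> where e: "p = (\<C>, \<D>)" by (cases p)
  have "card \<C>' * card \<D>' \<le> card \<C> * card \<D>"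
    if "\<C>' \<subseteq> nsets {1..m} r" "\<D>' \<subseteq> nsets {1..n} s" "cross t \<C>' \<D>'" for \<C>' \<D>'
    using p(2)[of "(\<C>', \<D>')"] that by (simp add: P_def f_def e)
  moreover have "\<C> \<subseteq> nsets {1..m} r" "\<D> \<subseteq> nsets {1..n} s" "cross t \<C> \<D>"
    using p(1) by (simp_all add: P_def e)
  ultimately have "uniform_optimal m n r s t \<C> \<D>" unfolding uniform_optimal_def by blast
  thus thesis by (rule that)
qed

text \<open>
  For \<open>s = t\<close> the ground sets may be too small for the preceding argument, but then the members of the two
  families all coincide.
\<close>
lemma cross_pair_bound:
  assumes t: "0 < t" "t \<le> r" "r \<le> s" and lam: "real t \<le> lam" "(real t + 4) / 2 < lam"
    and m: "(lam + 2) * (real s - t) + r - 1 \<le> m" and n: "(lam + 2) * (real s - t) + r - 1 \<le> n"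
    and A: "\<A> \<subseteq> nsets {1..m} r" and B: "\<B> \<subseteq> nsets {1..n} s" and c: "cross t \<A> \<B>"
  shows "card \<A> * card \<B> \<le> ((m - t) choose (r - t)) * ((n - t) choose (s - t)) \<and>
    (t < lam \<longrightarrow> card \<A> * card \<B> = ((m - t) choose (r - t)) * ((n - t) choose (s - t)) \<longrightarrow>
      (\<exists>T. card T = t \<and> T \<subseteq> {1..m} \<and> T \<subseteq> {1..n} \<and> \<A> = star m r T \<and> \<B> = star n s T))"
proof (cases "s = t")
  case True
  hence rt: "r = t" using t by simp
  have eq: "X = Y" if "X \<in> \<A>" "Y \<in> \<B>" for X Y
  proof -
    have X: "finite X" "card X = t" and Y: "finite Y" "card Y = t"
      using subsetD[OF A that(1)] subsetD[OF B that(2)] True rt by (simp_all add: nsets_iff)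
    have "t \<le> card (X \<inter> Y)" by (rule crossD[OF c that])
    hence c: "card X \<le> card (X \<inter> Y)" "card Y \<le> card (X \<inter> Y)" using X Y by simp_all
    have a: "X \<inter> Y = X" by (rule card_seteq[OF X(1) _ c(1)]) simp
    have b: "X \<inter> Y = Y" by (rule card_seteq[OF Y(1) _ c(2)]) simp
    show ?thesis by (rule trans[OF a[symmetric] b])
  qed
  show ?thesis
  proof (cases "\<A> = {} \<or> \<B> = {}")
    case True
    thus ?thesis using \<open>s = t\<close> rt by auto
  next
    case False
    then obtain X where X: "X \<in> \<A>" by auto
    hence XB: "\<B> = {X}" using eq False by blast
    hence XA: "\<A> = {X}" using eq X by blast
    have n: "X \<in> nsets {1..m} t" "X \<in> nsets {1..n} t" using A B XA XB True rt by auto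
    have "star M t X = {X}" if "X \<in> nsets {1..M} t" for M
    proof -
      have "Y = X" if "Y \<in> star M t X" for Y
      proof -
        have "X \<subseteq> Y" "finite Y" "card Y = t" using that by (auto simp: star_def nsets_iff)
        thus ?thesis using \<open>X \<in> nsets {1..M} t\<close> card_subset_eq[of Y X] by (simp add: nsets_iff)
      qed
      thus ?thesis using that by (auto simp: star_def)
    qed
    hence "\<A> = star m r X \<and> \<B> = star n s X" using n XA XB True rt by simp
    moreover have "card \<A> * card \<B> = 1" using XA XB by simp
    moreover have "card X = t" "X \<subseteq> {1..m}" "X \<subseteq> {1..n}" using n by (simp_all add: nsets_iff)
    ultimately show ?thesis using True rt by auto
  qed
next
  case False
  hence ts: "t < s" "t \<le> s" using t by auto
  let ?b = "((m - t) choose (r - t)) * ((n - t) choose (s - t))"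
  obtain \<C> \<D> where opt: "uniform_optimal m n r s t \<C> \<D>" by (rule uniform_optimal_exists)
  have "card \<A> * card \<B> \<le> card \<C> * card \<D>" using opt A B c unfolding uniform_optimal_def by blast
  also have CD: "\<dots> \<le> ?b" using uniform_optimal_bound[OF t ts(1) lam m n opt] by simp
  finally have le: "card \<A> * card \<B> \<le> ?b" .
  have "\<exists>T. card T = t \<and> T \<subseteq> {1..m} \<and> T \<subseteq> {1..n} \<and> \<A> = star m r T \<and> \<B> = star n s T"
    if tl: "t < lam" and e: "card \<A> * card \<B> = ?b"
  proof -
    have lam2: "2 < lam" using lam by simp
    note nm = ground_set_bound[OF m lam2 ts(1)] and nn = ground_set_bound[OF n lam2 ts(1)]
    have pos: "0 < (m - t) choose (r - t)" "0 < (n - t) choose (s - t)"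
      using nm nn t ts by (auto intro!: zero_less_binomial)
    have opt': "uniform_optimal m n r s t \<A> \<B>"
      unfolding uniform_optimal_def
    proof (intro conjI allI impI A B c)
      fix \<C>' \<D>' assume "\<C>' \<subseteq> nsets {1..m} r" "\<D>' \<subseteq> nsets {1..n} s" "cross t \<C>' \<D>'"
      hence "card \<C>' * card \<D>' \<le> card \<C> * card \<D>" using opt unfolding uniform_optimal_def by blast
      also note CD
      also note e[symmetric]
      finally show "card \<C>' * card \<D>' \<le> card \<A> * card \<B>" .
    qed
    from mp[OF conjunct2[OF uniform_optimal_bound[OF t ts(1) lam m n this]] tl]
    obtain T where T0: "card T = t \<and> (\<forall>X\<in>\<A> \<union> \<B>. T \<subseteq> X)" by (elim exE)
    note T = conjunct1[OF T0] bspec[OF conjunct2[OF T0]]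
    have "0 < card \<A> * card \<B>" using e pos by simp
    hence "\<A> \<noteq> {}" "\<B> \<noteq> {}" by auto
    then obtain X Y where XY: "X \<in> \<A>" "Y \<in> \<B>" by blast
    have "X \<subseteq> {1..m}" "Y \<subseteq> {1..n}"
      using subsetD[OF A XY(1)] subsetD[OF B XY(2)] by (simp_all add: nsets_iff)
    moreover have "T \<subseteq> X" "T \<subseteq> Y" using T(2)[of X] T(2)[of Y] XY by simp_all
    ultimately have Ts: "T \<subseteq> {1..m}" "T \<subseteq> {1..n}" by simp_all
    have "\<A> = star m r T \<and> \<B> = star n s T"
      by (rule optimal_full_star[OF opt' T(1) Ts t(2) ts(2) pos T(2)])
    with T(1) Ts show ?thesis by (intro exI[of _ T] conjI) simp_all
  qed
  with le show ?thesis by blast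
qed

section \<open>From pairs to several families\<close>

lemma star_inject:
  assumes T: "card T = t" "T \<subseteq> {1..m}" and T': "card T' = t" "T' \<subseteq> {1..m}"
    and r: "t \<le> r" "r = t \<or> r < m" and e: "star m r T = star m r T'"
  shows "T = T'"
proof -
  have fin: "finite T" "finite T'" using T T' finite_subset by blast+
  have "T' \<subseteq> T"
  proof
    fix z assume z: "z \<in> T'"
    show "z \<in> T"
    proof (rule ccontr)
      assume zT: "z \<notin> T"
      have "\<exists>S\<in>nsets ({1..m} - T) (r - t). z \<notin> S"
      proof (cases "r = t")
        case True thus ?thesis by simp
      next
        case False
        hence "r - t + card {z} \<le> card ({1..m} - T)" using r T fin by (simp add: card_Diff_subset)
        from nsets_avoiding[OF _ _ this] show ?thesis by (metis disjoint_insert(1) finite_Diff finite_atLeastAtMost finite.emptyI finite.insertI Int_commute)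
      qed
      then obtain S where S: "S \<in> nsets ({1..m} - T) (r - t)" "z \<notin> S" by blast
      have "T \<union> S \<in> star m r T" using star_eq_image[of T m r] T r S(1) by auto
      hence "T' \<subseteq> T \<union> S" unfolding e by (simp add: star_def)
      thus False using z zT S(2) by auto
    qed
  qed
  thus ?thesis using card_subset_eq[OF fin(1)] T T' by auto
qed

lemma prod_strict_less:
  fixes a c :: "'i \<Rightarrow> nat"
  assumes "finite I" "\<And>i. i \<in> I \<Longrightarrow> a i \<le> c i" "\<And>i. i \<in> I \<Longrightarrow> 0 < c i" "j \<in> I" "a j < c j"
  shows "prod a I < prod c I"
proof -
  have "prod a I = a j * prod a (I - {j})" using assms by (simp add: prod.remove)
  also have "\<dots> \<le> a j * prod c (I - {j})" using assms by (intro mult_left_mono prod_mono) auto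
  also have "\<dots> < c j * prod c (I - {j})" using assms by (intro mult_strict_right_mono prod_pos) auto
  also have "\<dots> = prod c I" using assms by (simp add: prod.remove)
  finally show ?thesis .
qed

text \<open>
  If \<open>a i0 > c i0\<close>, then \<open>a j < c j\<close> for all other \<open>j\<close>, and \<open>a i0 * a j0 \<le> c i0 * c j0\<close> for any one of them
  settles the bound. Equality then leaves no further index. In particular, equality of the products gives
  equality for each pair, although not at once for each factor.
\<close>
lemma prod_le_from_pairs:
  fixes a c :: "'i \<Rightarrow> nat"
  assumes fin: "finite I" and two: "p \<in> I" "q \<in> I" "p \<noteq> q" and c: "\<And>i. i \<in> I \<Longrightarrow> 0 < c i"
    and pair: "\<And>i j. i \<in> I \<Longrightarrow> j \<in> I \<Longrightarrow> i \<noteq> j \<Longrightarrow> a i * a j \<le> c i * c j"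
  shows "prod a I \<le> prod c I"
    and "prod a I = prod c I \<Longrightarrow> i \<in> I \<Longrightarrow> j \<in> I \<Longrightarrow> i \<noteq> j \<Longrightarrow> a i * a j = c i * c j"
proof -
  have "prod a I \<le> prod c I \<and>
    (prod a I = prod c I \<longrightarrow> (\<forall>i\<in>I. \<forall>j\<in>I. i \<noteq> j \<longrightarrow> a i * a j = c i * c j))"
  proof (cases "\<forall>i\<in>I. a i \<le> c i")
    case True
    have "a i = c i" if "prod a I = prod c I" "i \<in> I" for i
      using prod_strict_less[OF fin, of a c i] True c that by (metis le_neq_implies_less less_irrefl)
    moreover have "prod a I \<le> prod c I" using True by (intro prod_mono) auto
    ultimately show ?thesis by auto
  next
    case False
    then obtain i0 where i0: "i0 \<in> I" "c i0 < a i0" by (auto simp: not_le)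
    have small: "a j < c j" if "j \<in> I" "j \<noteq> i0" for j
    proof (rule ccontr)
      assume "\<not> a j < c j"
      hence "c i0 * c j < a i0 * a j" using i0 c[OF that(1)] by (intro mult_less_le_imp_less) auto
      thus False using pair[OF i0(1) that(1)] that by auto
    qed
    obtain j0 where j0: "j0 \<in> I" "j0 \<noteq> i0" using two by metis
    define R where "R = I - {i0} - {j0}"
    have split: "prod f I = (f i0 * f j0) * prod f R" for f :: "'i \<Rightarrow> nat"
      using fin i0 j0 unfolding R_def by (simp add: prod.remove[of I i0] prod.remove[of "I - {i0}" j0] mult.assoc)
    have pr: "a i0 * a j0 \<le> c i0 * c j0" using pair[OF i0(1) j0(1)] j0 by auto
    have R: "finite R" "\<And>j. j \<in> R \<Longrightarrow> a j < c j" "\<And>j. j \<in> R \<Longrightarrow> 0 < c j"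
      using fin small c unfolding R_def by auto
    have le: "prod a R \<le> prod c R" using R(2) by (intro prod_mono) (auto intro: less_imp_le)
    have main: "prod a I \<le> prod c I" unfolding split by (intro mult_mono pr le) auto
    have pos: "0 < c i0 * c j0" using c i0 j0 by simp
    have "a i * a j = c i * c j" if e: "prod a I = prod c I" and ij: "i \<in> I" "j \<in> I" "i \<noteq> j" for i j
    proof -
      have "R = {}"
      proof (rule ccontr)
        assume "R \<noteq> {}"
        then obtain j1 where "j1 \<in> R" by auto
        hence lt: "prod a R < prod c R" using R by (intro prod_strict_less[of R a c j1]) (auto intro: less_imp_le)
        have "prod a I \<le> (c i0 * c j0) * prod a R" unfolding split by (intro mult_right_mono pr) simp
        also have "\<dots> < (c i0 * c j0) * prod c R" using lt pos by simp
        also have "\<dots> = prod c I" by (rule split[symmetric])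
        finally show False using e by simp
      qed
      hence "i \<in> {i0, j0}" "j \<in> {i0, j0}" using ij unfolding R_def by auto
      moreover have "a i0 * a j0 = c i0 * c j0" using e unfolding split \<open>R = {}\<close> by simp
      ultimately show ?thesis using ij(3) by (auto simp: mult.commute)
    qed
    with main show ?thesis by blast
  qed
  thus "prod a I \<le> prod c I"
    "prod a I = prod c I \<Longrightarrow> i \<in> I \<Longrightarrow> j \<in> I \<Longrightarrow> i \<noteq> j \<Longrightarrow> a i * a j = c i * c j" by auto
qed

theorem theorem2p1:
  fixes k t :: nat and n r :: "nat \<Rightarrow> nat" and u :: real
    and \<A> :: "nat \<Rightarrow> nat set set"
  assumes "k \<ge> 2"
    and "t > 0"
    and "\<forall>i\<in>{1..k}. n i > 0"
    and "\<forall>i\<in>{1..k}. r i > 0"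
    and "t \<le> r 1"
    and "mono_on {1..k} r"
    and "u \<ge> 0"
    and "u > (6 - real t) / 3"
    and "real (Min (n ` {1..k})) \<ge>
           (real t + u + 2) * (real (r k) - real t) + real (r (k - 1)) - 1"
    and "\<forall>i\<in>{1..k}. \<A> i \<subseteq> nsets {1..n i} (r i)"
    and "cross_intersecting t k \<A>"
  shows "(\<Prod>i=1..k. card (\<A> i)) \<le> (\<Prod>i=1..k. (n i - t) choose (r i - t)) \<and>
    (u > 0 \<longrightarrow>
      ((\<Prod>i=1..k. card (\<A> i)) = (\<Prod>i=1..k. (n i - t) choose (r i - t)) \<longleftrightarrow>
        (\<exists>T\<in>nsets {1..Min (n ` {1..k})} t.
          \<forall>i\<in>{1..k}. \<A> i = {A \<in> nsets {1..n i} (r i). T \<subseteq> A})))"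
proof -
  define lam where "lam = real t + u"
  let ?I = "{1..k}"
  let ?N = "Min (n ` ?I)"
  let ?a = "\<lambda>i. card (\<A> i)" and ?c = "\<lambda>i. (n i - t) choose (r i - t)"
  have lam: "real t \<le> lam" "(real t + 4) / 2 < lam" "2 < lam"
    using assms(2,7,8) by (auto simp: lam_def)
  have in1: "1 \<in> ?I" "2 \<in> ?I" "k \<in> ?I" "k - 1 \<in> ?I" using assms(1) by auto
  have mono: "r i \<le> r j" if "i \<in> ?I" "j \<in> ?I" "i \<le> j" for i j
    using assms(6) that by (simp add: mono_on_def)
  have tr: "t \<le> r i" if "i \<in> ?I" for i
  proof -
    have "r 1 \<le> r i" using mono[OF in1(1) that] that by simp
    thus ?thesis using assms(5) by simp
  qed
  have Nn: "?N \<le> n i" if "i \<in> ?I" for i using that by (intro Min_le) auto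
  have room: "(lam + 2) * (real (r j) - t) + r i - 1 \<le> n h"
    if "i \<in> ?I" "j \<in> ?I" "i < j" "h \<in> ?I" for i j h
  proof -
    have "r j \<le> r k" "r i \<le> r (k - 1)" using mono[of j k] mono[of i "k - 1"] that in1 by auto
    hence "(lam + 2) * (real (r j) - t) + r i - 1 \<le> (lam + 2) * (real (r k) - t) + r (k - 1) - 1"
      using lam(3) by (intro diff_right_mono add_mono mult_left_mono) auto
    also have "\<dots> \<le> real ?N" using assms(9) by (simp add: lam_def)
    also have "\<dots> \<le> n h" using Nn[OF that(4)] by simp
    finally show ?thesis .
  qed
  have big: "r i < n i" if "i \<in> ?I" "t < r k" for i
  proof -
    have l: "k - 1 < k" using assms(1) by simp
    from ground_set_bound[OF room[OF in1(4,3) l that(1)] lam(3) that(2)]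
    have b: "4 * (r k - t) + r (k - 1) \<le> n i" .
    have "t \<le> r (k - 1)" by (rule tr[OF in1(4)])
    moreover have "r i \<le> r k" using mono[OF that(1) in1(3)] that by simp
    ultimately show ?thesis using b that(2) by linarith
  qed
  have cpos: "0 < ?c i" if "i \<in> ?I" for i
  proof (cases "r i = t")
    case False
    have "r i \<le> r k" using mono[OF that in1(3)] that by simp
    hence "t < r k" using False tr[OF that] by simp
    thus ?thesis using big[OF that] by (intro zero_less_binomial) simp
  qed simp
  have pairs: "?a i * ?a j \<le> ?c i * ?c j \<and>
      (t < lam \<longrightarrow> ?a i * ?a j = ?c i * ?c j \<longrightarrow>
        (\<exists>T. card T = t \<and> T \<subseteq> {1..n i} \<and> T \<subseteq> {1..n j} \<and>
          \<A> i = star (n i) (r i) T \<and> \<A> j = star (n j) (r j) T))"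
    if ij: "i \<in> ?I" "j \<in> ?I" "i < j" for i j
  proof (rule cross_pair_bound[OF assms(2) tr[OF ij(1)] _ lam(1,2)])
    show "r i \<le> r j" using mono ij by simp
    show "(lam + 2) * (real (r j) - real t) + real (r i) - 1 \<le> real (n i)"
      by (rule room[OF ij ij(1)])
    show "(lam + 2) * (real (r j) - real t) + real (r i) - 1 \<le> real (n j)"
      by (rule room[OF ij ij(2)])
    show "\<A> i \<subseteq> nsets {1..n i} (r i)" "\<A> j \<subseteq> nsets {1..n j} (r j)" using assms(10) ij by auto
    show "cross t (\<A> i) (\<A> j)"
      using assms(11) ij unfolding cross_intersecting_def cross_def by (metis less_irrefl)
  qed
  have pair: "?a i * ?a j \<le> ?c i * ?c j" if ij: "i \<in> ?I" "j \<in> ?I" "i \<noteq> j" for i j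
  proof (cases "i < j")
    case True thus ?thesis using pairs ij by blast
  next
    case False
    hence "?a j * ?a i \<le> ?c j * ?c i" using pairs[OF ij(2,1)] ij(3) by simp
    thus ?thesis by (simp add: mult.commute)
  qed
  have fin: "finite ?I" and ne12: "(1::nat) \<noteq> 2" by simp_all
  have prod_le: "prod ?a ?I \<le> prod ?c ?I"
    by (rule prod_le_from_pairs(1)[OF fin in1(1,2) ne12]) (use cpos pair in blast)+
  have pair_eq: "?a i * ?a j = ?c i * ?c j"
    if "prod ?a ?I = prod ?c ?I" "i \<in> ?I" "j \<in> ?I" "i \<noteq> j" for i j
    by (rule prod_le_from_pairs(2)[OF fin in1(1,2) ne12 _ _ that]) (use cpos pair in blast)+
  have "\<exists>T\<in>nsets {1..?N} t. \<forall>i\<in>?I. \<A> i = {A \<in> nsets {1..n i} (r i). T \<subseteq> A}"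
    if u: "u > 0" and e: "prod ?a ?I = prod ?c ?I"
  proof -
    have tl: "t < lam" using u by (simp add: lam_def)
    \<comment> \<open>Every family is paired with the first one; the centres found in this way agree because the first
      family is a star with only one centre.\<close>
    have ex: "\<exists>T. card T = t \<and> T \<subseteq> {1..n 1} \<and> T \<subseteq> {1..n j} \<and>
          \<A> 1 = star (n 1) (r 1) T \<and> \<A> j = star (n j) (r j) T" if j: "j \<in> ?I" "j \<noteq> 1" for j
    proof -
      have "1 < j" using j by auto
      moreover have "?a 1 * ?a j = ?c 1 * ?c j" using pair_eq[OF e in1(1) j(1)] j(2) by simp
      ultimately show ?thesis using pairs[OF in1(1) j(1)] tl by blast
    qed
    obtain T where T: "card T = t" "T \<subseteq> {1..n 1}" "\<A> 1 = star (n 1) (r 1) T"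
      using ex[OF in1(2)] by auto
    have r1: "r 1 = t \<or> r 1 < n 1"
      using big[OF in1(1)] mono[OF in1(1,3)] assms(1) tr[OF in1(1)] by fastforce
    have all: "T \<subseteq> {1..n j} \<and> \<A> j = star (n j) (r j) T" if j: "j \<in> ?I" for j
    proof (cases "j = 1")
      case True thus ?thesis using T by simp
    next
      case False
      from ex[OF j False] obtain T' where T': "card T' = t" "T' \<subseteq> {1..n 1}" "T' \<subseteq> {1..n j}"
        "\<A> 1 = star (n 1) (r 1) T'" "\<A> j = star (n j) (r j) T'" by auto
      have "star (n 1) (r 1) T = star (n 1) (r 1) T'" using T(3) T'(4) by simp
      from star_inject[OF T(1,2) T'(1,2) tr[OF in1(1)] r1 this] T' show ?thesis by simp
    qed
    have "?N \<in> n ` ?I" using in1 by (intro Min_in) auto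
    then obtain h where "h \<in> ?I" "?N = n h" by auto
    hence "T \<subseteq> {1..?N}" using all by metis
    moreover have "finite T" using T(2) finite_subset by blast
    ultimately have "T \<in> nsets {1..?N} t" using T(1) by (simp add: nsets_iff)
    moreover have "\<forall>i\<in>?I. \<A> i = {A \<in> nsets {1..n i} (r i). T \<subseteq> A}" using all by (simp add: star_def)
    ultimately show ?thesis by blast
  qed
  moreover have "prod ?a ?I = prod ?c ?I"
    if T: "T \<in> nsets {1..?N} t" and all: "\<forall>i\<in>?I. \<A> i = {A \<in> nsets {1..n i} (r i). T \<subseteq> A}" for T
  proof (rule prod.cong[OF refl])
    fix i assume i: "i \<in> ?I"
    have "T \<subseteq> {1..n i}" "card T = t" using T Nn[OF i] by (force simp: nsets_iff)+
    moreover have "\<A> i = star (n i) (r i) T" using all i by (simp add: star_def)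
    ultimately show "?a i = ?c i" using card_star[of T "n i" "r i"] tr[OF i] by simp
  qed
  ultimately show ?thesis using prod_le by blast
qed

end
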